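(* Let $f:\mathbb{R}^d\to\mathbb{R}$ be continuous with a unique $x^*\in\mathbb{R}^d$ such that $f(x^* )=\min f=:\underline f$; assume there is $L_f>0$ with $|f(x)-f(y)|\le L_f(1+|x|+|y|)|x-y|$ for all $x,y\in\mathbb{R}^d$, and there are $c_\ell,c_u,M>0$ with $f(x)-\underline f\le c_u(|x|^2+1)$ for all $x\in\mathbb{R}^d$ and $c_\ell|x|^2\le f(x)-\underline f$ for $|x|\ge M$. Let $\rho_0,\varrho_0\in\mathcal P_2(\mathbb{R}^d)$ be arbitrary initial measures, and let $\rho_t^\alpha$ and $\varrho_t^{\alpha,s,\Delta t}$ be the solutions (laws) of the $\delta$-CBO scheme and the Consensus Freezing scheme, respectively, with $\rho_0^\alpha=\rho_0$ and $\varrho_0^{\alpha,s,\Delta t}=\varrho_0$. Then $$\rho_t^\alpha=\mathcal N(0,\Sigma_t)\ast\Big((s_{k_t,c^1_\gamma(t)})_\#\rho_0\Big),\qquad \varrho_t^{\alpha,s,\Delta t}=\mathcal N(0,\Sigma_t)\ast\Big((s_{k_t,c^2_\gamma(t)})_\#\varrho_0\Big),$$ where $\Sigma_t=\frac{D}{\lambda}(1-\exp(-2\lambda t))I_d$ with $D:=\frac{\delta^2}{2}$, $k_t:=e^{-\lambda t}$ and, for $j=1,2$, $c^j_\gamma(t)$ is the solution to the differential equation $$\frac{d}{dt}c^j_\gamma(t)=-\lambda\,(c^j_\gamma(t)-\gamma^j_t),\qquad c^j_\gamma(0)=0,$$ where $\gamma^1_t:=X^\alpha(\rho_t^\alpha)$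 ($\delta$-CBO scheme) and $\gamma^2_t:=X^\alpha(\varrho_{t_i}^{\alpha,s,\Delta t})$ for $t_i\le t<t_{i+1}$ (Consensus Freezing scheme).
   Context: For a probability measure $\rho$ on $\mathbb{R}^d$ and $\alpha>0$, the consensus point is $X^\alpha(\rho)=\frac{\int x e^{-\alpha f(x)}d\rho(x)}{\int e^{-\alpha f(x)}d\rho(x)}$. For $k\in\mathbb{R}$ and $z\in\mathbb{R}^d$, $s_{k,z}:\mathbb{R}^d\to\mathbb{R}^d$ is the map $s_{k,z}(y)=ky+z$. The symbol $\ast$ is convolution of measures, $g_\#\rho$ is the pushforward of $\rho$ under $g$, and $\mathcal P_2(\mathbb{R}^d)$ is the set of probability measures with finite second moment. The parameters $\alpha,\lambda,\delta,s,\Delta t$ are positive, and $B_t$ is a standard $d$-dimensional Brownian motion. $\delta$-CBO scheme: $dX_t=-\lambda(X_t-X^\alpha(\rho_t^\alpha))dt+\delta\,dB_t$, $\rho_t^\alpha=\mathrm{Law}(X_t)$. Consensus Freezing scheme: $dX_t=-s\lambda\big(X_t-X^\alpha(\varrho^{\alpha,s,\Delta t}_{t_i})\big)dt+\sqrt s\,\delta\,dB_t$ for $t\in[t_i,t_{i+1})$, $t_i=i\Delta t$, $\varrho^{\alpha,s,\Delta t}_t=\mathrm{Law}(X_t)$.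
   Formalization: For the Consensus Freezing scheme the printed formula fails when s ≠ 1 (e.g. f(x)=x², Dirac initial law: wrong variance); the formal statement uses Σ_{st}, k_{st} and the equation for c² with rate sλ in place of Σ_t, k_t and rate λ, agreeing with the printed one at s = 1. *)

theory Defs
  imports "HOL-Probability.Probability"
begin

definition P2 :: "(real^'n) measure set" where
  "P2 = {\<mu>. prob_space \<mu> \<and> sets \<mu> = sets borel \<and> integrable \<mu> (\<lambda>x. (norm x)\<^sup>2)}"

definition consensus_point :: "real \<Rightarrow> (real^'n \<Rightarrow> real) \<Rightarrow> (real^'n) measure \<Rightarrow> real^'n" where
  "consensus_point \<alpha> f \<rho> =
     (LINT x|\<rho>. exp (- \<alpha> * f x) *\<^sub>R x) /\<^sub>R (LINT x|\<rho>. exp (- \<alpha> * f x))"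

definition scale_shift :: "real \<Rightarrow> real^'n \<Rightarrow> real^'n \<Rightarrow> real^'n" where
  "scale_shift k z y = k *\<^sub>R y + z"

definition std_gaussian :: "(real^'n) measure" where
  "std_gaussian = density lborel (\<lambda>x. ennreal (\<Prod>i\<in>UNIV. std_normal_density (x $ i)))"

definition psd_sqrt :: "real^'n^'n \<Rightarrow> real^'n^'n" where
  "psd_sqrt \<Sigma> = (THE A. transpose A = A \<and> (\<forall>v. 0 \<le> v \<bullet> (A *v v)) \<and> A ** A = \<Sigma>)"

text \<open>The normal distribution with mean \<open>m\<close> and covariance \<open>\<Sigma>\<close> is the law of
  \<open>m + \<Sigma>\<^sup>1\<^sup>/\<^sup>2 Z\<close> for a standard Gaussian vector \<open>Z\<close>. This makes sense for every positive
  semidefinite \<open>\<Sigma>\<close>; in particular covariance zero gives the Dirac measure at \<open>m\<close>, which is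
  the case that occurs at time zero.\<close>

definition gaussian :: "real^'n \<Rightarrow> real^'n^'n \<Rightarrow> (real^'n) measure" where
  "gaussian m \<Sigma> = distr std_gaussian borel (\<lambda>z. m + psd_sqrt \<Sigma> *v z)"

text \<open>Only the time parameters \<open>t \<ge> 0\<close> are meaningful. In the increments axiom the infinite
  sequence \<open>\<tau>\<close> is only a way to write a finite partition.\<close>

locale brownian_motion = prob_space M
  for M :: "'w measure" and B :: "real \<Rightarrow> 'w \<Rightarrow> real^'n" +
  assumes rv: "\<And>t. 0 \<le> t \<Longrightarrow> B t \<in> borel_measurable M"
    and start_zero: "AE \<omega> in M. B 0 \<omega> = 0"
    and indep_increments: "\<And>(\<tau> :: nat \<Rightarrow> real) n. 0 \<le> \<tau> 0 \<Longrightarrow> mono \<tau> \<Longrightarrow>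
          indep_vars (\<lambda>_. borel) (\<lambda>i \<omega>. B (\<tau> (Suc i)) \<omega> - B (\<tau> i) \<omega>) {..<n}"
    and gaussian_increments: "\<And>r t. 0 \<le> r \<Longrightarrow> r < t \<Longrightarrow>
          distr M borel (\<lambda>\<omega>. B t \<omega> - B r \<omega>) = gaussian 0 ((t - r) *\<^sub>R mat 1)"
    and continuous_paths: "AE \<omega> in M. continuous_on {0..} (\<lambda>t. B t \<omega>)"

definition law :: "'w measure \<Rightarrow> (real \<Rightarrow> 'w \<Rightarrow> real^'n) \<Rightarrow> real \<Rightarrow> (real^'n) measure" where
  "law M X t = distr M borel (X t)"

text \<open>Solutions on \<open>[0, \<infinity>)\<close> of \<open>dX\<^sub>t = - a (X\<^sub>t - \<gamma>\<^sub>t) dt + b dB\<^sub>t\<close> with initial law \<open>\<rho>0\<close>, where \<open>\<gamma>\<close> is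
  deterministic. The noise coefficient is constant, so the stochastic integral of the noise term is
  \<open>b (B\<^sub>t - B\<^sub>0) = b B\<^sub>t\<close> and the integrated equation can be read pathwise. As usual, the initial
  value is independent of the Brownian motion; the two generate the sigma algebras below.\<close>

definition sde_solution ::
    "'w measure \<Rightarrow> (real \<Rightarrow> 'w \<Rightarrow> real^'n) \<Rightarrow> real \<Rightarrow> real \<Rightarrow> (real \<Rightarrow> real^'n) \<Rightarrow>
     (real^'n) measure \<Rightarrow> (real \<Rightarrow> 'w \<Rightarrow> real^'n) \<Rightarrow> bool" where
  "sde_solution M B a b \<gamma> \<rho>0 X \<longleftrightarrow>
     brownian_motion M B \<and>
     (\<forall>t\<ge>0. X t \<in> borel_measurable M) \<and>
     (AE \<omega> in M. continuous_on {0..} (\<lambda>t. X t \<omega>)) \<and>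
     law M X 0 = \<rho>0 \<and>
     prob_space.indep_set M
       (sets (vimage_algebra (space M) (X 0) borel))
       (sets (vimage_algebra (space M) (\<lambda>\<omega>. \<lambda>t\<in>{0..}. B t \<omega>) (\<Pi>\<^sub>M t\<in>{0..}. borel))) \<and>
     (AE \<omega> in M. \<forall>t\<ge>0.
        (\<lambda>r. X r \<omega> - \<gamma> r) integrable_on {0..t} \<and>
        X t \<omega> = X 0 \<omega> + integral {0..t} (\<lambda>r. - a *\<^sub>R (X r \<omega> - \<gamma> r)) + b *\<^sub>R B t \<omega>)"

definition cbo_gamma ::
    "real \<Rightarrow> (real^'n \<Rightarrow> real) \<Rightarrow> (real \<Rightarrow> (real^'n) measure) \<Rightarrow> real \<Rightarrow> real^'n" where
  "cbo_gamma \<alpha> f \<rho> t = consensus_point \<alpha> f (\<rho> t)"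

text \<open>For \<open>i \<Delta>t \<le> t < (i + 1) \<Delta>t\<close> the floor below is \<open>i\<close>.\<close>

definition freezing_gamma ::
    "real \<Rightarrow> (real^'n \<Rightarrow> real) \<Rightarrow> real \<Rightarrow> (real \<Rightarrow> (real^'n) measure) \<Rightarrow> real \<Rightarrow> real^'n" where
  "freezing_gamma \<alpha> f \<Delta>t \<rho> t = consensus_point \<alpha> f (\<rho> (of_int \<lfloor>t / \<Delta>t\<rfloor> * \<Delta>t))"

definition cbo_solution ::
    "(real^'n \<Rightarrow> real) \<Rightarrow> real \<Rightarrow> real \<Rightarrow> real \<Rightarrow> 'w measure \<Rightarrow> (real \<Rightarrow> 'w \<Rightarrow> real^'n) \<Rightarrow>
     (real^'n) measure \<Rightarrow> (real \<Rightarrow> 'w \<Rightarrow> real^'n) \<Rightarrow> bool" where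
  "cbo_solution f \<alpha> lam \<delta> M B \<rho>0 X \<longleftrightarrow>
     sde_solution M B lam \<delta> (cbo_gamma \<alpha> f (law M X)) \<rho>0 X"

definition freezing_solution ::
    "(real^'n \<Rightarrow> real) \<Rightarrow> real \<Rightarrow> real \<Rightarrow> real \<Rightarrow> real \<Rightarrow> real \<Rightarrow> 'w measure \<Rightarrow>
     (real \<Rightarrow> 'w \<Rightarrow> real^'n) \<Rightarrow> (real^'n) measure \<Rightarrow> (real \<Rightarrow> 'w \<Rightarrow> real^'n) \<Rightarrow> bool" where
  "freezing_solution f \<alpha> lam \<delta> s \<Delta>t M B \<rho>0 X \<longleftrightarrow>
     sde_solution M B (s * lam) (sqrt s * \<delta>) (freezing_gamma \<alpha> f \<Delta>t (law M X)) \<rho>0 X"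

definition contraction :: "real \<Rightarrow> real \<Rightarrow> real" where
  "contraction lam t = exp (- lam * t)"

definition diffusion_cov :: "real \<Rightarrow> real \<Rightarrow> real \<Rightarrow> real^'n^'n" where
  "diffusion_cov lam \<delta> t = (let D = \<delta>\<^sup>2 / 2 in (D / lam * (1 - exp (- 2 * lam * t))) *\<^sub>R mat 1)"

definition center_ode ::
    "real set \<Rightarrow> real \<Rightarrow> (real \<Rightarrow> real^'n) \<Rightarrow> (real \<Rightarrow> real^'n) \<Rightarrow> bool" where
  "center_ode T a \<gamma> c \<longleftrightarrow>
     (\<forall>t\<in>T. (c has_vector_derivative (- a *\<^sub>R (c t - \<gamma> t))) (at t within T))"

definition cbo_center :: "real \<Rightarrow> (real \<Rightarrow> real^'n) \<Rightarrow> (real \<Rightarrow> real^'n) \<Rightarrow> bool" where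
  "cbo_center a \<gamma> c \<longleftrightarrow> c 0 = 0 \<and> center_ode {0..} a \<gamma> c"

text \<open>In the freezing scheme \<open>\<gamma>\<close> jumps at the grid points, where \<open>c\<close> has different left and right
  derivatives. The equation therefore holds on each interval \<open>[i \<Delta>t, (i + 1) \<Delta>t)\<close> separately, and
  the pieces are joined by continuity.\<close>

definition freezing_center ::
    "real \<Rightarrow> real \<Rightarrow> (real \<Rightarrow> real^'n) \<Rightarrow> (real \<Rightarrow> real^'n) \<Rightarrow> bool" where
  "freezing_center \<Delta>t a \<gamma> c \<longleftrightarrow> c 0 = 0 \<and> continuous_on {0..} c \<and>
     (\<forall>i::nat. center_ode {real i * \<Delta>t..<real (Suc i) * \<Delta>t} a \<gamma> c)"

text \<open>The freezing scheme has drift rate \<open>s lam\<close> and noise \<open>sqrt s \<delta>\<close>, i.e. it is the plain scheme run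
  at speed \<open>s\<close>. Its contraction factor and covariance at time \<open>t\<close> are thus \<open>contraction lam (s * t)\<close>
  and \<open>diffusion_cov lam \<delta> (s * t)\<close>, and its center solves the equation with rate \<open>s lam\<close>. For
  \<open>s = 1\<close> they coincide with those of the plain scheme.\<close>

end

(* The noise of the equation is additive and its drift is linear with a deterministic input, so each
   path satisfies X_t = e^(-at) X_0 + c(t) + b V_t with V_t = B_t - int_0^t a e^(-a(t-r)) B_r dr:
   off the finitely many jumps of the input the difference h of both sides solves h' = -a h, h(0) = 0.
   The variable V_t is the limit of the sums of e^(-a(t-r_i)) (B_(r_(i+1)) - B_(r_i)) over equidistant
   partitions. These sums are Gaussian and independent of X_0, so their limit contributes the
   convolution with a Gaussian of variance (1 - e^(-2at)) / (2a).
   The centers are c(t) = e^(-at) int_0^t a e^(ar) gamma_r dr. For the plain scheme gamma is continuous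
   by dominated convergence, because the growth of f makes e^(-alpha f(x)) |x| bounded. *)

theory Submission
  imports Defs
begin

section \<open>Isotropic Gaussian measures\<close>

text \<open>The input of each equation is computed from the law of the unknown process. Once a
  solution is given, this input is a fixed function of time and the equation is linear;
  \<open>sde_solution_law\<close> therefore treats both schemes at once, with the jumps of the input
  collected in a finite set \<open>K\<close>. The obstacle is the roughness of the Brownian path:
  both the differential equation argument and the convergence of the sums may use only its
  continuity. They can, because the path is always met after an integration by parts: V_t contains
  it under an ordinary integral, and the sums converge for every continuous path since the weight
  e^(-a(t-r)) is smooth and increasing in r. So everything stays pathwise, and almost sure
  convergence passes to laws through bounded continuous test functions. The variances of the sums
  are sums of the same type, with the identity as path. Independence of X_0 is transferred to the
  finite sums rather than to V_t, because they depend on finitely many coordinates and so are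
  measurable for the product sigma algebra.\<close>

lemma matrix_vector_mult_scaleR_mat: "(k *\<^sub>R mat 1 :: real^'n^'n) *v x = k *\<^sub>R x"
  by (simp add: scaleR_matrix_vector_assoc[symmetric])

text \<open>\<open>psd_sqrt\<close> is a definite description, so uniqueness of the root is the
  point. If A is symmetric, positive semidefinite and A A = v I with v > 0, then A maps A x - sqrt v
  x to its multiple by -sqrt v, and semidefiniteness forces this vector to vanish. For v = 0
  symmetry gives |A x|^2 = x . (A A x) = 0.\<close>

lemma psd_sqrt_scaled_mat:
  assumes "0 \<le> v"
  shows "psd_sqrt (v *\<^sub>R mat 1 :: real^'n^'n) = sqrt v *\<^sub>R mat 1"
  unfolding psd_sqrt_def
proof (rule the_equality)
  show "transpose (sqrt v *\<^sub>R mat 1 :: real^'n^'n) = sqrt v *\<^sub>R mat 1 \<and>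
      (\<forall>x. 0 \<le> x \<bullet> ((sqrt v *\<^sub>R mat 1 :: real^'n^'n) *v x)) \<and>
      (sqrt v *\<^sub>R mat 1 :: real^'n^'n) ** (sqrt v *\<^sub>R mat 1) = v *\<^sub>R mat 1"
    using assms
    by (simp add: matrix_vector_mult_scaleR_mat transpose_scalar scalar_matrix_assoc[symmetric] matrix_scalar_ac)
next
  fix A :: "real^'n^'n"
  assume A: "transpose A = A \<and> (\<forall>x. 0 \<le> x \<bullet> (A *v x)) \<and> A ** A = v *\<^sub>R mat 1"
  have sym: "x \<bullet> (A *v y) = (A *v x) \<bullet> y" for x y
    using A by (metis dot_lmul_matrix vector_transpose_matrix)
  have AA: "A *v (A *v x) = v *\<^sub>R x" for x
    using A by (simp add: matrix_vector_mul_assoc matrix_vector_mult_scaleR_mat)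
  have "A *v x = sqrt v *\<^sub>R x" for x
  proof (cases "v = 0")
    case True
    have "(A *v x) \<bullet> (A *v x) = x \<bullet> (A *v (A *v x))"
      by (simp add: sym)
    with True show ?thesis by (simp add: AA)
  next
    case False
    define w where "w = A *v x - sqrt v *\<^sub>R x"
    have "A *v w = - sqrt v *\<^sub>R w"
      using assms
      by (simp add: w_def matrix_vector_mult_diff_distrib AA matrix_vector_mult_scaleR algebra_simps)
    with A have "0 \<le> - sqrt v * (w \<bullet> w)"
      by (metis inner_scaleR_right)
    moreover have "0 < sqrt v" using False assms by simp
    ultimately have "w = 0"
      by (metis inner_ge_zero inner_eq_zero_iff mult_minus_left neg_0_le_iff_le mult_pos_pos
          less_eq_real_def not_less)
    then show ?thesis by (simp add: w_def)
  qed
  then show "A = sqrt v *\<^sub>R mat 1"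
    by (simp add: matrix_eq matrix_vector_mult_scaleR_mat)
qed

lemma sets_std_gaussian [simp, measurable_cong]: "sets std_gaussian = sets borel"
  by (simp add: std_gaussian_def)

lemma sets_gaussian [simp, measurable_cong]: "sets (gaussian m \<Sigma>) = sets borel"
  by (simp add: gaussian_def)

lemma gaussian_scaled_mat:
  assumes "0 \<le> v"
  shows "gaussian 0 (v *\<^sub>R mat 1) = distr std_gaussian borel (\<lambda>z. sqrt v *\<^sub>R z)"
  using assms by (simp add: gaussian_def psd_sqrt_scaled_mat matrix_vector_mult_scaleR_mat)

lemma prod_Basis_vec: "(\<Prod>b\<in>(Basis::(real^'n) set). F b) = (\<Prod>i\<in>UNIV. F (axis i 1))"
proof -
  have B: "(Basis::(real^'n) set) = range (\<lambda>i. axis i 1)"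
    by (auto simp: Basis_vec_def)
  have "inj (\<lambda>i. axis i 1 :: real^'n)"
    by (auto simp: inj_on_def axis_eq_axis)
  then show ?thesis
    unfolding B by (subst prod.reindex) (auto simp: inj_on_def)
qed

lemma nn_integral_lborel_prod_vec:
  fixes h :: "'n::finite \<Rightarrow> real \<Rightarrow> ennreal"
  assumes [measurable]: "\<And>i. h i \<in> borel_measurable borel"
  shows "(\<integral>\<^sup>+x. (\<Prod>i\<in>UNIV. h i ((x::real^'n) $ i)) \<partial>lborel) = (\<Prod>i\<in>UNIV. \<integral>\<^sup>+x. h i x \<partial>lborel)"
proof -
  \<comment> \<open>The product formula for \<open>lborel\<close> runs over \<open>Basis\<close>, so
    the factors are reindexed by basis vectors; \<open>SOME\<close> inverts the injective map i to
    \<open>axis i 1\<close>.\<close>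
  define H where "H b = h (SOME i. b = axis i (1::real))" for b :: "real^'n"
  have H: "H (axis i 1) = h i" for i
    by (simp add: H_def axis_eq_axis)
  have "(\<integral>\<^sup>+x. (\<Prod>i\<in>UNIV. h i ((x::real^'n) $ i)) \<partial>lborel)
      = (\<integral>\<^sup>+x. (\<Prod>b\<in>Basis. H b ((x::real^'n) \<bullet> b)) \<partial>lborel)"
    by (simp add: prod_Basis_vec H inner_axis)
  also have "\<dots> = (\<Prod>b\<in>Basis. \<integral>\<^sup>+x. H b x \<partial>lborel)"
    by (rule nn_integral_lborel_prod) (auto simp: H_def)
  finally show ?thesis by (simp add: prod_Basis_vec H)
qed

lemma gaussian_scaled_mat_density:
  assumes "0 < \<sigma>"
  shows "gaussian 0 (\<sigma>\<^sup>2 *\<^sub>R mat 1 :: real^'n^'n) =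
     density lborel (\<lambda>x. \<Prod>i\<in>UNIV. ennreal (normal_density 0 \<sigma> (x $ i)))"
proof -
  let ?p = "\<lambda>x::real^'n. ennreal (\<Prod>i\<in>UNIV. std_normal_density (x $ i))"
  have [measurable]: "?p \<in> borel_measurable borel" by measurable
  have "gaussian 0 (\<sigma>\<^sup>2 *\<^sub>R mat 1 :: real^'n^'n) = distr (density lborel ?p) borel (\<lambda>z. \<sigma> *\<^sub>R z)"
    using assms by (simp add: gaussian_scaled_mat std_gaussian_def)
  \<comment> \<open>Writing z as (1/\<sigma>) (\<sigma> z) makes the density a function of the image
    point, so that it can be pulled through \<open>distr\<close>.\<close>
  also have "\<dots> = distr (density lborel (\<lambda>z. ?p ((1/\<sigma>) *\<^sub>R (\<sigma> *\<^sub>R z)))) borel (\<lambda>z. \<sigma> *\<^sub>R z)"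
    using assms by simp
  also have "\<dots> = density (distr lborel borel (\<lambda>z. \<sigma> *\<^sub>R z)) (\<lambda>x. ?p ((1/\<sigma>) *\<^sub>R x))"
    using density_distr[of "\<lambda>x. ?p ((1/\<sigma>) *\<^sub>R x)" borel "\<lambda>z. \<sigma> *\<^sub>R z" lborel] by simp
  \<comment> \<open>The Jacobian \<sigma>^n and its inverse are inserted so that
    \<open>lborel_affine\<close> recognizes the inner \<open>density\<close> as
    \<open>lborel\<close>.\<close>
  also have "\<dots> = density (density (distr lborel borel (\<lambda>z. \<sigma> *\<^sub>R z)) (\<lambda>_. \<bar>\<sigma>\<bar>^CARD('n)))
      (\<lambda>x. ennreal (1 / \<sigma>^CARD('n)) * ?p ((1/\<sigma>) *\<^sub>R x))"
    using assms
    by (subst density_density_eq)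
       (auto intro!: density_cong simp: mult.assoc[symmetric] ennreal_mult''[symmetric] simp del: ennreal_mult'')
  also have "\<dots> = density lborel (\<lambda>x. ennreal (1 / \<sigma>^CARD('n)) * ?p ((1/\<sigma>) *\<^sub>R x))"
    using lborel_affine[of \<sigma> "0::real^'n"] assms by simp
  also have "\<dots> = density lborel (\<lambda>x. \<Prod>i\<in>UNIV. ennreal (normal_density 0 \<sigma> (x $ i)))"
  proof (intro arg_cong[where f = "density lborel"] ext)
    fix x :: "real^'n"
    have "normal_density 0 \<sigma> y = 1 / \<sigma> * std_normal_density (1 / \<sigma> * y)" for y
      using assms by (simp add: normal_density_def power_divide real_sqrt_mult mult.commute)
    then show "ennreal (1 / \<sigma>^CARD('n)) * ?p ((1/\<sigma>) *\<^sub>R x) = (\<Prod>i\<in>UNIV. ennreal (normal_density 0 \<sigma> (x $ i)))"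
      using assms
      by (simp add: prod_ennreal normal_density_nonneg ennreal_mult'[symmetric] prod.distrib prod_dividef
         flip: ennreal_mult'')
  qed
  finally show ?thesis .
qed

lemma prob_space_std_gaussian: "prob_space (std_gaussian :: (real^'n) measure)"
proof
  have "emeasure (std_gaussian :: (real^'n) measure) (space std_gaussian)
      = (\<integral>\<^sup>+x. (\<Prod>i\<in>UNIV. ennreal (std_normal_density ((x::real^'n) $ i))) \<partial>lborel)"
    unfolding std_gaussian_def by (simp add: emeasure_density prod_ennreal)
  also have "\<dots> = 1"
  proof (subst nn_integral_lborel_prod_vec)
    have "(\<integral>\<^sup>+x. ennreal (std_normal_density x) \<partial>lborel) = 1"
      using prob_space.emeasure_space_1[OF prob_space_normal_density[of 1 0]]
      by (simp add: emeasure_density)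
    then show "(\<Prod>i\<in>(UNIV::'n set). \<integral>\<^sup>+ x. ennreal (std_normal_density x) \<partial>lborel) = 1" by simp
  qed simp
  finally show "emeasure (std_gaussian :: (real^'n) measure) (space std_gaussian) = 1" .
qed

lemma prob_space_gaussian: "prob_space (gaussian m \<Sigma>)"
  unfolding gaussian_def
  by (rule prob_space.prob_space_distr[OF prob_space_std_gaussian])
     (auto intro!: borel_measurable_continuous_onI continuous_intros matrix_vector_mult_linear_continuous_on
        simp: measurable_cong_sets[OF sets_std_gaussian refl])

lemma gaussian_zero: "gaussian 0 (0 :: real^'n^'n) = return borel 0"
proof -
  have "gaussian 0 (0 :: real^'n^'n) = distr (std_gaussian :: (real^'n) measure) borel (\<lambda>_. 0)"
    using gaussian_scaled_mat[of 0] by simp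
  then show ?thesis
    by (simp add: prob_space.distr_const[OF prob_space_std_gaussian])
qed

section \<open>Convolution of isotropic Gaussians\<close>

lemma convolution_return_zero:
  assumes "finite_measure N" and [simp]: "sets N = sets borel"
  shows "(return borel 0 \<star> N) = N"
proof (rule measure_eqI)
  fix A assume "A \<in> sets (return borel 0 \<star> N)"
  then have A [measurable]: "A \<in> sets borel" by simp
  interpret finite_measure N by fact
  have [measurable_cong]: "sets N = sets borel" by simp
  have "(\<lambda>x. \<integral>\<^sup>+y. indicator A (x + y) \<partial>N) \<in> borel_measurable borel"
    by measurable
  then show "emeasure (return borel 0 \<star> N) A = emeasure N A"
    by (subst convolution_emeasure')
       (auto simp: nn_integral_return assms intro!: prob_space_return prob_space.finite_measure)
qed simp

text \<open>Translation invariance moves the shift from the set into the density, and Tonelli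
  exchanges the two integrals. Swapping the factors first makes f the inner density, the one that
  receives the shift.\<close>

lemma convolution_density_euclidean:
  fixes f g :: "'a::ordered_euclidean_space \<Rightarrow> ennreal"
  assumes [measurable]: "f \<in> borel_measurable borel" "g \<in> borel_measurable borel"
    and fin: "finite_measure (density lborel f)" "finite_measure (density lborel g)"
  shows "(density lborel f \<star> density lborel g) = density lborel (\<lambda>x. \<integral>\<^sup>+y. f (x - y) * g y \<partial>lborel)"
proof (rule measure_eqI)
  fix A assume "A \<in> sets (density lborel f \<star> density lborel g)"
  then have [measurable]: "A \<in> sets borel" by simp
  have translate: "(\<integral>\<^sup>+x. f x * indicator A (y + x) \<partial>lborel) = (\<integral>\<^sup>+x. f (x - y) * indicator A x \<partial>lborel)" for y
    by (subst (2) lborel_distr_plus[of y, symmetric]) (simp add: nn_integral_distr)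
  have "emeasure (density lborel f \<star> density lborel g) A = emeasure (density lborel g \<star> density lborel f) A"
    using fin by (simp add: convolution_commutative)
  also have "\<dots> = (\<integral>\<^sup>+y. g y * (\<integral>\<^sup>+x. f x * indicator A (y + x) \<partial>lborel) \<partial>lborel)"
    using fin by (simp add: convolution_emeasure' nn_integral_density)
  also have "\<dots> = (\<integral>\<^sup>+y. (\<integral>\<^sup>+x. f (x - y) * g y * indicator A x \<partial>lborel) \<partial>lborel)"
    by (simp add: translate nn_integral_cmult[symmetric] ac_simps)
  also have "\<dots> = (\<integral>\<^sup>+x. (\<integral>\<^sup>+y. f (x - y) * g y * indicator A x \<partial>lborel) \<partial>lborel)"
    by (intro lborel_pair.Fubini') simp
  finally show "emeasure (density lborel f \<star> density lborel g) A =
      emeasure (density lborel (\<lambda>x. \<integral>\<^sup>+y. f (x - y) * g y \<partial>lborel)) A"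
    by (simp add: emeasure_density nn_integral_multc)
qed simp

text \<open>For positive variances the densities are products over the coordinates, and in each
  coordinate the variances of two centered normals add. A Gaussian of variance zero has no density,
  but it is the unit of convolution.\<close>

lemma convolution_gaussian:
  assumes "0 \<le> v" "0 \<le> w"
  shows "(gaussian 0 (v *\<^sub>R mat 1 :: real^'n^'n) \<star> gaussian 0 (w *\<^sub>R mat 1)) = gaussian 0 ((v + w) *\<^sub>R mat 1)"
proof -
  have fin: "finite_measure (gaussian 0 (u *\<^sub>R mat 1 :: real^'n^'n))" for u
    by (rule prob_space.finite_measure[OF prob_space_gaussian])
  consider "v = 0" | "w = 0" | "0 < v" "0 < w" using assms by fastforce
  then show ?thesis
  proof cases
    case 1 then show ?thesis
      by (simp add: gaussian_zero convolution_return_zero fin)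
  next
    case 2
    have "(gaussian 0 (v *\<^sub>R mat 1 :: real^'n^'n) \<star> gaussian 0 (w *\<^sub>R mat 1))
       = (gaussian 0 (w *\<^sub>R mat 1) \<star> gaussian 0 (v *\<^sub>R mat 1))"
      by (rule convolution_commutative) (auto simp: fin)
    with 2 show ?thesis
      by (simp add: gaussian_zero convolution_return_zero fin)
  next
    case 3
    define \<sigma> \<tau> where "\<sigma> = sqrt v" and "\<tau> = sqrt w"
    have pos: "0 < \<sigma>" "0 < \<tau>" "0 < sqrt (\<sigma>\<^sup>2 + \<tau>\<^sup>2)" and vw: "v = \<sigma>\<^sup>2" "w = \<tau>\<^sup>2" "v + w = (sqrt (\<sigma>\<^sup>2 + \<tau>\<^sup>2))\<^sup>2"
      using 3 by (simp_all add: \<sigma>_def \<tau>_def)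
    let ?d = "\<lambda>\<sigma> x. \<Prod>i\<in>UNIV. ennreal (normal_density 0 \<sigma> ((x::real^'n) $ i))"
    have "(gaussian 0 (v *\<^sub>R mat 1 :: real^'n^'n) \<star> gaussian 0 (w *\<^sub>R mat 1))
       = density lborel (\<lambda>x. \<integral>\<^sup>+y. ?d \<sigma> (x - y) * ?d \<tau> y \<partial>lborel)"
      using fin[of v] fin[of w] unfolding vw(1,2) gaussian_scaled_mat_density[OF pos(1)] gaussian_scaled_mat_density[OF pos(2)]
      by (intro convolution_density_euclidean) auto
    also have "(\<lambda>x. \<integral>\<^sup>+y. ?d \<sigma> (x - y) * ?d \<tau> y \<partial>lborel) = ?d (sqrt (\<sigma>\<^sup>2 + \<tau>\<^sup>2))"
    proof
      fix x :: "real^'n"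
      have "(\<integral>\<^sup>+y. ?d \<sigma> (x - y) * ?d \<tau> y \<partial>lborel)
        = (\<integral>\<^sup>+y. (\<Prod>i\<in>UNIV. ennreal (normal_density 0 \<sigma> (x $ i - y $ i) * normal_density 0 \<tau> (y $ i))) \<partial>lborel)"
        by (simp add: prod.distrib[symmetric] ennreal_mult' normal_density_nonneg)
      also have "\<dots> = (\<Prod>i\<in>UNIV. \<integral>\<^sup>+y. ennreal (normal_density 0 \<sigma> (x $ i - y) * normal_density 0 \<tau> y) \<partial>lborel)"
        by (subst nn_integral_lborel_prod_vec) auto
      also have "\<dots> = ?d (sqrt (\<sigma>\<^sup>2 + \<tau>\<^sup>2)) x"
        using fun_cong[OF conv_normal_density_zero_mean[OF pos(1,2)]] by simp
      finally show "(\<integral>\<^sup>+y. ?d \<sigma> (x - y) * ?d \<tau> y \<partial>lborel) = ?d (sqrt (\<sigma>\<^sup>2 + \<tau>\<^sup>2)) x" .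
    qed
    also have "density lborel (?d (sqrt (\<sigma>\<^sup>2 + \<tau>\<^sup>2))) = gaussian 0 ((v + w) *\<^sub>R mat 1)"
      unfolding vw(3) gaussian_scaled_mat_density[OF pos(3)] ..
    finally show ?thesis .
  qed
qed

section \<open>Linear differential equations and Riemann--Stieltjes sums\<close>

text \<open>The integrating factor e^(at) makes the derivative of e^(at) h vanish off K, and for a
  continuous function the fundamental theorem of calculus tolerates finitely many exceptional
  points. K will hold the jump times of the input.\<close>

lemma linear_ode_zero_unique:
  fixes h :: "real \<Rightarrow> 'a::banach"
  assumes "0 \<le> T" "continuous_on {0..T} h" "h 0 = 0" "finite K"
    and h': "\<And>t. t \<in> {0<..<T} - K \<Longrightarrow> (h has_vector_derivative - a *\<^sub>R h t) (at t)"
  shows "h T = 0"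
proof -
  have "((\<lambda>_. 0) has_integral exp (a * T) *\<^sub>R h T - exp (a * 0) *\<^sub>R h 0) {0..T}"
  proof (rule fundamental_theorem_of_calculus_interior_strong[OF \<open>finite K\<close> \<open>0 \<le> T\<close>])
    fix t assume "t \<in> {0<..<T} - K"
    from h'[OF this] show "((\<lambda>t. exp (a * t) *\<^sub>R h t) has_vector_derivative 0) (at t)"
      by (auto intro!: derivative_eq_intros simp: has_real_derivative_iff_has_vector_derivative[symmetric])
  qed (intro continuous_intros assms)
  then have "exp (a * T) *\<^sub>R h T = 0"
    using has_integral_unique[OF has_integral_0] \<open>h 0 = 0\<close> by fastforce
  then show ?thesis by simp
qed

text \<open>Variation of constants for c' = -a (c - \<gamma>), c 0 = 0. It serves twice: with the
  consensus input it is the center, and with a Brownian path in place of \<gamma> it is the integral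
  subtracted in V_t.\<close>

definition exp_center :: "real \<Rightarrow> (real \<Rightarrow> 'a::banach) \<Rightarrow> real \<Rightarrow> 'a" where
  "exp_center a \<gamma> t = exp (- a * t) *\<^sub>R integral {0..t} (\<lambda>r. (a * exp (a * r)) *\<^sub>R \<gamma> r)"

lemma exp_center_0 [simp]: "exp_center a \<gamma> 0 = 0"
  by (simp add: exp_center_def)

text \<open>The shape {p..q} - F of the domain covers all uses: interior points, the one-sided
  derivative at 0, and a half-open grid cell, where F is the right endpoint at which the input may
  jump.\<close>

lemma exp_center_has_vector_derivative:
  fixes \<gamma> :: "real \<Rightarrow> 'a::banach"
  assumes int: "(\<lambda>r. (a * exp (a * r)) *\<^sub>R \<gamma> r) integrable_on {0..q}"
    and "0 \<le> p" "finite F" and t: "t \<in> {p..q} - F"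
    and cont: "continuous (at t within ({p..q} - F)) \<gamma>"
  shows "(exp_center a \<gamma> has_vector_derivative - a *\<^sub>R (exp_center a \<gamma> t - \<gamma> t)) (at t within ({p..q} - F))"
proof -
  let ?w = "\<lambda>r. (a * exp (a * r)) *\<^sub>R \<gamma> r"
  \<comment> \<open>Continuity of \<gamma> is known only within {p..q} - F, so the integral is
    started at p; the part over {0..p} is a constant that is added back.\<close>
  have "((\<lambda>u. integral {p..u} ?w) has_vector_derivative ?w t) (at t within ({p..q} - F))"
    using assms by (intro integral_has_vector_derivative_continuous_at continuous_intros integrable_subinterval_real[OF int]) auto
  then have D: "((\<lambda>u. exp (- a * u) *\<^sub>R (integral {0..p} ?w + integral {p..u} ?w)) has_vector_derivative
     - a *\<^sub>R (exp (- a * t) *\<^sub>R (integral {0..p} ?w + integral {p..t} ?w)) + exp (- a * t) *\<^sub>R ?w t)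
     (at t within ({p..q} - F))"
    by (auto intro!: derivative_eq_intros simp: has_real_derivative_iff_has_vector_derivative[symmetric])
  have E: "exp_center a \<gamma> u = exp (- a * u) *\<^sub>R (integral {0..p} ?w + integral {p..u} ?w)" if "u \<in> {p..q} - F" for u
  proof -
    have "?w integrable_on {0..u}"
      using that by (intro integrable_subinterval_real[OF int]) auto
    then show ?thesis
      unfolding exp_center_def using that \<open>0 \<le> p\<close> by (subst Henstock_Kurzweil_Integration.integral_combine) auto
  qed
  have wt: "exp (- a * t) *\<^sub>R ?w t = a *\<^sub>R \<gamma> t"
    by (simp add: exp_add[symmetric] mult.left_commute[of _ a])
  have "(exp_center a \<gamma> has_vector_derivative
     - a *\<^sub>R (exp_center a \<gamma> t) + a *\<^sub>R \<gamma> t) (at t within ({p..q} - F))"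
    using has_vector_derivative_transform[OF t E D] unfolding wt E[OF t, symmetric] by simp
  then show ?thesis by (simp add: algebra_simps)
qed

text \<open>An indefinite integral is continuous for every integrable integrand, hence the center
  stays continuous across jumps of the input.\<close>

lemma continuous_on_exp_center:
  fixes \<gamma> :: "real \<Rightarrow> 'a::banach"
  assumes "\<And>T. (\<lambda>r. (a * exp (a * r)) *\<^sub>R \<gamma> r) integrable_on {0..T}"
  shows "continuous_on {0..} (exp_center a \<gamma>)"
proof -
  have "isCont (\<lambda>t. integral {0..t} (\<lambda>r. (a * exp (a * r)) *\<^sub>R \<gamma> r)) x" if "0 < x" for x
    using continuous_on_interior[OF indefinite_integral_continuous_1[OF assms[of "x + 1"]], of x] that
    by auto
  moreover have "continuous (at 0 within {0..}) (\<lambda>t. integral {0..t} (\<lambda>r. (a * exp (a * r)) *\<^sub>R \<gamma> r))"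
  proof -
    have "continuous (at 0 within {0..1}) (\<lambda>t. integral {0..t} (\<lambda>r. (a * exp (a * r)) *\<^sub>R \<gamma> r))"
      using indefinite_integral_continuous_1[OF assms[of 1]] by (auto simp: continuous_on_eq_continuous_within)
    moreover have "at (0::real) within {0..} = at 0 within {0..1}"
      by (rule at_within_nhd[of _ "{..<1}"]) auto
    ultimately show ?thesis by simp
  qed
  ultimately have "continuous_on {0..} (\<lambda>t. integral {0..t} (\<lambda>r. (a * exp (a * r)) *\<^sub>R \<gamma> r))"
    unfolding continuous_on_eq_continuous_within
    by (metis atLeast_iff continuous_at_imp_continuous_within less_eq_real_def)
  then show ?thesis
    unfolding exp_center_def[abs_def] by (intro continuous_intros)
qed

text \<open>The path \<beta> is merely continuous. But x - b \<beta> is \<open>x 0\<close> plus an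
  integral, and \<open>exp_center a \<beta>\<close> is differentiable as well, so the difference of
  the two sides can be differentiated off K although the sides themselves in general cannot.\<close>

lemma integral_equation_explicit:
  fixes x \<beta> \<gamma> c :: "real \<Rightarrow> 'a::banach"
  assumes "0 \<le> T" and x: "continuous_on {0..T} x" and \<beta>: "continuous_on {0..T} \<beta>" "\<beta> 0 = 0"
    and int: "(\<lambda>r. x r - \<gamma> r) integrable_on {0..T}"
    and eq: "\<And>t. t \<in> {0..T} \<Longrightarrow> x t = x 0 + integral {0..t} (\<lambda>r. - a *\<^sub>R (x r - \<gamma> r)) + b *\<^sub>R \<beta> t"
    and "finite K" and \<gamma>: "\<And>t. t \<in> {0<..<T} - K \<Longrightarrow> isCont \<gamma> t"
    and c: "c 0 = 0" "continuous_on {0..T} c"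
      "\<And>t. t \<in> {0<..<T} - K \<Longrightarrow> (c has_vector_derivative - a *\<^sub>R (c t - \<gamma> t)) (at t)"
  shows "x T = exp (- a * T) *\<^sub>R x 0 + c T + b *\<^sub>R (\<beta> T - exp_center a \<beta> T)"
proof -
  define I where "I t = integral {0..t} (\<lambda>r. - a *\<^sub>R (x r - \<gamma> r))" for t
  have int': "(\<lambda>r. - a *\<^sub>R (x r - \<gamma> r)) integrable_on {0..T}"
    using int by (rule integrable_cmul)
  have int\<beta>: "(\<lambda>r. (a * exp (a * r)) *\<^sub>R \<beta> r) integrable_on {0..T}"
    by (intro integrable_continuous_real continuous_intros \<beta>)
  \<comment> \<open>\<open>x t - b *\<^sub>R \<beta> t\<close> appears here as
    \<open>x 0 + I t\<close>, the form that can be differentiated; \<open>hx\<close> restores the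
    original form, in which h' = -a h can be read off.\<close>
  define h where "h t = (x 0 + I t) - exp (- a * t) *\<^sub>R x 0 - c t + b *\<^sub>R exp_center a \<beta> t" for t
  have hx: "h t = x t - b *\<^sub>R \<beta> t - exp (- a * t) *\<^sub>R x 0 - c t + b *\<^sub>R exp_center a \<beta> t" if "t \<in> {0..T}" for t
    using eq[OF that] by (simp add: h_def I_def algebra_simps)
  have "h T = 0"
  proof (rule linear_ode_zero_unique[OF \<open>0 \<le> T\<close> _ _ \<open>finite K\<close>, where a = a])
    show "continuous_on {0..T} h"
      unfolding h_def I_def exp_center_def
      by (intro continuous_intros c indefinite_integral_continuous_1 int' int\<beta>)
    show "h 0 = 0" using c by (simp add: h_def I_def)
    fix t assume t: "t \<in> {0<..<T} - K"
    then have at: "at t within {0..T} = at t"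
      by (intro at_within_interior) auto
    have xt: "isCont x t"
      using continuous_on_interior[OF x, of t] t by auto
    have \<beta>t: "isCont \<beta> t"
      using continuous_on_interior[OF \<beta>(1), of t] t by auto
    have I: "(I has_vector_derivative - a *\<^sub>R (x t - \<gamma> t)) (at t)"
      using integral_has_vector_derivative_continuous_at[OF int', of t "{}"] t at xt \<gamma>[OF t]
      unfolding I_def[abs_def] by (auto intro!: continuous_intros)
    have J: "(exp_center a \<beta> has_vector_derivative - a *\<^sub>R (exp_center a \<beta> t - \<beta> t)) (at t)"
      using exp_center_has_vector_derivative[OF int\<beta>, of 0 "{}" t] t at \<beta>t by auto
    have "(h has_vector_derivative
      - a *\<^sub>R (x t - \<gamma> t) + (a * exp (- a * t)) *\<^sub>R x 0 - (- a *\<^sub>R (c t - \<gamma> t)) + b *\<^sub>R (- a *\<^sub>R (exp_center a \<beta> t - \<beta> t))) (at t)"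
      unfolding h_def using I J c(3)[OF t]
      by (auto intro!: derivative_eq_intros simp: has_real_derivative_iff_has_vector_derivative[symmetric])
    also have "- a *\<^sub>R (x t - \<gamma> t) + (a * exp (- a * t)) *\<^sub>R x 0 - (- a *\<^sub>R (c t - \<gamma> t)) + b *\<^sub>R (- a *\<^sub>R (exp_center a \<beta> t - \<beta> t))
       = - a *\<^sub>R h t"
      using t by (simp add: hx algebra_simps)
    finally show "(h has_vector_derivative - a *\<^sub>R h t) (at t)" .
  qed
  with hx[of T] \<open>0 \<le> T\<close> show ?thesis by (simp add: algebra_simps)
qed

section \<open>Convergence of sums against a continuous integrator\<close>

lemma sum_by_parts_scaleR:
  fixes b :: "nat \<Rightarrow> 'a::real_vector"
  shows "(\<Sum>i<N. g i *\<^sub>R (b (Suc i) - b i)) = g N *\<^sub>R b N - g 0 *\<^sub>R b 0 - (\<Sum>i<N. (g (Suc i) - g i) *\<^sub>R b (Suc i))"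
  by (induction N) (auto simp: algebra_simps)

text \<open>The error of one partition cell: g' is a nonnegative weight of total mass g q - g p, so
  replacing \<beta> by the constant v costs at most \<epsilon> times this mass.\<close>

lemma integral_scaleR_bound_endpoint:
  fixes \<beta> :: "real \<Rightarrow> 'a::banach"
  assumes "p \<le> q" and \<beta>: "continuous_on {p..q} \<beta>" and g': "continuous_on {p..q} g'"
    and g: "\<And>r. r \<in> {p..q} \<Longrightarrow> (g has_real_derivative g' r) (at r within {p..q})"
    and nonneg: "\<And>r. r \<in> {p..q} \<Longrightarrow> 0 \<le> g' r"
    and bound: "\<And>r. r \<in> {p..q} \<Longrightarrow> norm (\<beta> r - v) \<le> \<epsilon>"
  shows "norm (integral {p..q} (\<lambda>r. g' r *\<^sub>R \<beta> r) - (g q - g p) *\<^sub>R v) \<le> (g q - g p) * \<epsilon>"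
proof -
  have G: "(g' has_integral (g q - g p)) {p..q}"
    using g \<open>p \<le> q\<close> by (intro fundamental_theorem_of_calculus) (auto simp: has_real_derivative_iff_has_vector_derivative)
  have "((\<lambda>r. g' r *\<^sub>R \<beta> r - g' r *\<^sub>R v) has_integral
     (integral {p..q} (\<lambda>r. g' r *\<^sub>R \<beta> r) - (g q - g p) *\<^sub>R v)) {p..q}"
    by (intro has_integral_diff integrable_integral integrable_continuous_real continuous_intros \<beta> g'
        has_integral_scaleR_left G)
  moreover have "((\<lambda>r. g' r * \<epsilon>) has_integral (g q - g p) * \<epsilon>) {p..q}"
    using G by (rule has_integral_mult_left)
  moreover have "norm (g' r *\<^sub>R \<beta> r - g' r *\<^sub>R v) \<le> g' r * \<epsilon>" if "r \<in> {p..q}" for r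
    using nonneg[OF that] bound[OF that] by (simp add: scaleR_diff_right[symmetric] mult_left_mono)
  ultimately show ?thesis
    by (metis (no_types, lifting) Henstock_Kurzweil_Integration.integral_norm_bound_integral
        has_integral_integrable integral_unique)
qed

lemma integral_partition_sum:
  fixes \<tau> :: "nat \<Rightarrow> real" and F :: "real \<Rightarrow> 'a::banach"
  assumes "mono \<tau>" "F integrable_on {\<tau> 0..\<tau> N}" "k \<le> N"
  shows "integral {\<tau> 0..\<tau> k} F = (\<Sum>i<k. integral {\<tau> i..\<tau> (Suc i)} F)"
  using \<open>k \<le> N\<close>
proof (induction k)
  case (Suc k)
  have le: "\<tau> 0 \<le> \<tau> k" "\<tau> k \<le> \<tau> (Suc k)" "\<tau> (Suc k) \<le> \<tau> N"
    using Suc.prems by (auto intro!: monoD[OF \<open>mono \<tau>\<close>])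
  have "F integrable_on {\<tau> 0..\<tau> (Suc k)}"
    using assms(2) by (rule integrable_subinterval_real) (use le in auto)
  from Henstock_Kurzweil_Integration.integral_combine[OF le(1,2) this] Suc show ?case by simp
qed simp

text \<open>No bound on the variation of \<beta> is available, so summation by parts shifts the
  increments to g. What remains are values of \<beta> against increments of a monotone function,
  controlled by uniform continuity of \<beta>. Taking \<open>Suc n\<close> cells avoids a mesh with
  denominator 0.\<close>

lemma riemann_stieltjes_sum_tendsto:
  fixes \<beta> :: "real \<Rightarrow> 'a::banach"
  assumes "0 \<le> T" and \<beta>: "continuous_on {0..T} \<beta>" and g': "continuous_on {0..T} g'"
    and g: "\<And>r. r \<in> {0..T} \<Longrightarrow> (g has_real_derivative g' r) (at r within {0..T})"
    and nonneg: "\<And>r. r \<in> {0..T} \<Longrightarrow> 0 \<le> g' r"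
  shows "(\<lambda>n. \<Sum>i<Suc n. g (T * real i / real (Suc n)) *\<^sub>R
             (\<beta> (T * real (Suc i) / real (Suc n)) - \<beta> (T * real i / real (Suc n))))
         \<longlonglongrightarrow> g T *\<^sub>R \<beta> T - g 0 *\<^sub>R \<beta> 0 - integral {0..T} (\<lambda>r. g' r *\<^sub>R \<beta> r)"
    (is "?S \<longlonglongrightarrow> ?L")
proof (rule LIMSEQ_I)
  fix e :: real assume "0 < e"
  have "(g' has_integral (g T - g 0)) {0..T}"
    using g \<open>0 \<le> T\<close> by (intro fundamental_theorem_of_calculus) (auto simp: has_real_derivative_iff_has_vector_derivative)
  then have g_le: "0 \<le> g T - g 0"
    using nonneg by (rule has_integral_nonneg)
  \<comment> \<open>The added 1 keeps the denominator positive when g is constant and makes the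
    final estimate strict.\<close>
  define \<epsilon> where "\<epsilon> = e / (g T - g 0 + 1)"
  have pos: "0 < g T - g 0 + 1" using g_le by simp
  then have "0 < \<epsilon>" using \<open>0 < e\<close> by (simp add: \<epsilon>_def)
  have "uniformly_continuous_on {0..T} \<beta>"
    by (rule compact_uniformly_continuous[OF \<beta>]) simp
  then obtain d where "0 < d" and d: "\<And>r r'. r \<in> {0..T} \<Longrightarrow> r' \<in> {0..T} \<Longrightarrow> dist r r' < d \<Longrightarrow> dist (\<beta> r) (\<beta> r') < \<epsilon>"
    unfolding uniformly_continuous_on_def using \<open>0 < \<epsilon>\<close> by metis
  obtain n0 :: nat where n0: "T / d < real n0" using reals_Archimedean2 by blast
  have "norm (?S n - ?L) < e" if "n0 \<le> n" for n
  proof -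
    define N where "N = Suc n"
    define \<tau> where "\<tau> i = T * real i / real N" for i
    have "0 < N" by (simp add: N_def)
    have "mono \<tau>" using \<open>0 \<le> T\<close> by (auto simp: mono_def \<tau>_def intro!: divide_right_mono mult_left_mono)
    have \<tau>0: "\<tau> 0 = 0" and \<tau>N: "\<tau> N = T" using \<open>0 < N\<close> by (auto simp: \<tau>_def)
    have \<tau>_le: "0 \<le> \<tau> i" "\<tau> i \<le> \<tau> (Suc i)" "\<tau> (Suc i) \<le> T" if "i < N" for i
      using monoD[OF \<open>mono \<tau>\<close>, of 0 i] monoD[OF \<open>mono \<tau>\<close>, of i "Suc i"] monoD[OF \<open>mono \<tau>\<close>, of "Suc i" N] that \<tau>0 \<tau>N by auto
    have "T < d * real N"
    proof -
      have "T < d * real n0" using n0 \<open>0 < d\<close> by (simp add: field_simps)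
      also have "\<dots> \<le> d * real N" using that \<open>0 < d\<close> by (intro mult_left_mono) (auto simp: N_def)
      finally show ?thesis .
    qed
    then have "T / real N < d" using \<open>0 < N\<close> by (simp add: field_simps)
    then have step: "\<tau> (Suc i) - \<tau> i < d" for i
      by (simp add: \<tau>_def distrib_left add_divide_distrib)
    have int: "(\<lambda>r. g' r *\<^sub>R \<beta> r) integrable_on {0..T}"
      by (intro integrable_continuous_real continuous_intros \<beta> g')
    \<comment> \<open>The boundary terms of the summation by parts cancel those of
      \<open>?L\<close>; each cell leaves the error of evaluating \<beta> at its right
      endpoint.\<close>
    have "?S n - ?L = (\<Sum>i<N. integral {\<tau> i..\<tau> (Suc i)} (\<lambda>r. g' r *\<^sub>R \<beta> r) - (g (\<tau> (Suc i)) - g (\<tau> i)) *\<^sub>R \<beta> (\<tau> (Suc i)))"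
      using sum_by_parts_scaleR[of "\<lambda>i. g (\<tau> i)" "\<lambda>i. \<beta> (\<tau> i)" N]
        integral_partition_sum[OF \<open>mono \<tau>\<close>, of "\<lambda>r. g' r *\<^sub>R \<beta> r" N N] int
      unfolding \<tau>0 \<tau>N by (simp add: sum_subtractf \<tau>_def N_def)
    also have "norm \<dots> \<le> (\<Sum>i<N. (g (\<tau> (Suc i)) - g (\<tau> i)) * \<epsilon>)"
    proof (rule sum_norm_le)
      fix i assume "i \<in> {..<N}"
      then have i: "0 \<le> \<tau> i" "\<tau> i \<le> \<tau> (Suc i)" "\<tau> (Suc i) \<le> T" using \<tau>_le by auto
      show "norm (integral {\<tau> i..\<tau> (Suc i)} (\<lambda>r. g' r *\<^sub>R \<beta> r) - (g (\<tau> (Suc i)) - g (\<tau> i)) *\<^sub>R \<beta> (\<tau> (Suc i)))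
        \<le> (g (\<tau> (Suc i)) - g (\<tau> i)) * \<epsilon>"
      proof (rule integral_scaleR_bound_endpoint)
        fix r assume r: "r \<in> {\<tau> i..\<tau> (Suc i)}"
        then have "dist r (\<tau> (Suc i)) < d" using step[of i] by (auto simp: dist_real_def)
        then show "norm (\<beta> r - \<beta> (\<tau> (Suc i))) \<le> \<epsilon>"
          using d[of r "\<tau> (Suc i)"] r i by (auto simp: dist_norm)
      qed (use i in \<open>auto intro!: nonneg has_field_derivative_subset[OF g] continuous_on_subset[OF \<beta>] continuous_on_subset[OF g']\<close>)
    qed
    also have "\<dots> = (g T - g 0) * \<epsilon>"
      using sum_lessThan_telescope[of "\<lambda>i. g (\<tau> i)" N] by (simp add: sum_distrib_right[symmetric] \<tau>0 \<tau>N)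
    also have "\<dots> < (g T - g 0 + 1) * \<epsilon>" using \<open>0 < \<epsilon>\<close> by simp
    also have "\<dots> = e" using pos by (simp add: \<epsilon>_def)
    finally show ?thesis .
  qed
  then show "\<exists>n0. \<forall>n\<ge>n0. norm (?S n - ?L) < e" by blast
qed

section \<open>Limits of laws and the Brownian path\<close>

text \<open>Closed sets are stable under intersection and generate the Borel sets, and the indicator
  of a nonempty closed C is the limit of the continuous functions max(0, 1 - n dist(x, C)).\<close>

lemma measure_eqI_bounded_continuous:
  fixes M N :: "'a::metric_space measure"
  assumes fin: "finite_measure M" "finite_measure N" and sets [simp, measurable_cong]: "sets M = sets borel" "sets N = sets borel"
    and eq: "\<And>\<phi>::'a \<Rightarrow> real. continuous_on UNIV \<phi> \<Longrightarrow> (\<And>x. 0 \<le> \<phi> x \<and> \<phi> x \<le> 1) \<Longrightarrow> (LINT x|M. \<phi> x) = (LINT x|N. \<phi> x)"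
  shows "M = N"
proof (rule measure_eqI_generator_eq)
  interpret M: finite_measure M by fact
  interpret N: finite_measure N by fact
  show "Int_stable (Collect closed :: 'a set set)" by (auto simp: Int_stable_def)
  show "sets M = sigma_sets UNIV (Collect closed)" "sets N = sigma_sets UNIV (Collect closed)"
    by (simp_all add: borel_eq_closed)
  show "range (\<lambda>_::nat. UNIV) \<subseteq> (Collect closed :: 'a set set)" by auto
  show "emeasure M UNIV \<noteq> \<infinity>" by simp
  fix C :: "'a set" assume "C \<in> Collect closed"
  then have C: "closed C" and [measurable]: "C \<in> sets borel" by auto
  show "emeasure M C = emeasure N C"
  \<comment> \<open>The empty set is treated apart because \<open>infdist x {}\<close> is 0, which
    would make every \<open>\<phi> n\<close> equal to 1.\<close>
  proof (cases "C = {}")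
    case False
    define \<phi> where "\<phi> n x = max 0 (1 - real n * infdist x C)" for n x
    have \<phi>: "continuous_on UNIV (\<phi> n)" for n
      unfolding \<phi>_def by (intro continuous_intros)
    have [measurable]: "\<phi> n \<in> borel_measurable borel" for n
      by (rule borel_measurable_continuous_onI[OF \<phi>])
    have range: "0 \<le> \<phi> n x \<and> \<phi> n x \<le> 1" for n x
      by (auto simp: \<phi>_def infdist_nonneg)
    have lim: "(\<lambda>n. \<phi> n x) \<longlonglongrightarrow> indicator C x" for x
    proof (cases "x \<in> C")
      case True then show ?thesis by (simp add: \<phi>_def)
    next
      case outside: False
      then have pos: "0 < infdist x C"
        using C False by (simp add: infdist_pos_not_in_closed)
      obtain m :: nat where "1 / infdist x C < real m" using reals_Archimedean2 by blast
      then have m: "1 < real m * infdist x C" using pos by (simp add: field_simps)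
      have "\<phi> n x = 0" if "m \<le> n" for n
      proof -
        have "real m * infdist x C \<le> real n * infdist x C"
          using that pos by (intro mult_right_mono) auto
        with m show ?thesis by (simp add: \<phi>_def)
      qed
      then show ?thesis
        using outside by (intro tendsto_eventually) (auto simp: eventually_sequentially)
    qed
    have "(\<lambda>n. LINT x|M. \<phi> n x) \<longlonglongrightarrow> (LINT x|M. indicator C x)"
      by (rule integral_dominated_convergence[where w = "\<lambda>_. 1"]) (use lim range in auto)
    moreover have "(\<lambda>n. LINT x|N. \<phi> n x) \<longlonglongrightarrow> (LINT x|N. indicator C x)"
      by (rule integral_dominated_convergence[where w = "\<lambda>_. 1"]) (use lim range in auto)
    ultimately have "measure M C = measure N C"
      using eq[OF \<phi> range] LIMSEQ_unique by simp
    then show ?thesis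
      by (simp add: M.emeasure_eq_measure N.emeasure_eq_measure)
  qed simp
qed auto

text \<open>Realizes these convolutions for all v on one fixed probability space, with the variance
  only as a scale factor. Convergence of variances thereby becomes pointwise convergence, degenerate
  Gaussians included.\<close>

lemma convolution_gaussian_eq_distr:
  fixes \<mu> :: "(real^'n) measure"
  assumes "0 \<le> v" "prob_space \<mu>" and [simp, measurable_cong]: "sets \<mu> = sets borel"
  shows "(gaussian 0 (v *\<^sub>R mat 1) \<star> \<mu>) = distr (std_gaussian \<Otimes>\<^sub>M \<mu>) borel (\<lambda>(z, y). sqrt v *\<^sub>R z + y)"
proof -
  interpret prob_space \<mu> by fact
  have "gaussian 0 (v *\<^sub>R mat 1 :: real^'n^'n) \<Otimes>\<^sub>M \<mu> = distr std_gaussian borel (\<lambda>z. sqrt v *\<^sub>R z) \<Otimes>\<^sub>M distr \<mu> borel (\<lambda>y. y)"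
    using assms by (simp add: gaussian_scaled_mat distr_id2)
  also have "\<dots> = distr (std_gaussian \<Otimes>\<^sub>M \<mu>) (borel \<Otimes>\<^sub>M borel) (\<lambda>(z, y). (sqrt v *\<^sub>R z, y))"
    by (rule pair_measure_distr) (auto simp: distr_id2 sigma_finite_measure)
  finally have "gaussian 0 (v *\<^sub>R mat 1 :: real^'n^'n) \<Otimes>\<^sub>M \<mu>
      = distr (std_gaussian \<Otimes>\<^sub>M \<mu>) (borel \<Otimes>\<^sub>M borel) (\<lambda>(z, y). (sqrt v *\<^sub>R z, y))" .
  then show ?thesis
    by (simp add: convolution_def distr_distr comp_def case_prod_beta')
qed

text \<open>Integrals of a bounded continuous test function converge by dominated convergence in two
  ways: along the almost surely convergent variables, and along \<open>sqrt (v n)\<close> in the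
  product representation. The two limits must agree.\<close>

lemma (in prob_space) distr_limit_gaussian_convolution:
  fixes S :: "nat \<Rightarrow> 'a \<Rightarrow> real^'n"
  assumes [measurable]: "\<And>n. S n \<in> borel_measurable M" "Y \<in> borel_measurable M"
    and lim: "AE \<omega> in M. (\<lambda>n. S n \<omega>) \<longlonglongrightarrow> Y \<omega>"
    and law: "\<And>n. distr M borel (S n) = (gaussian 0 (v n *\<^sub>R mat 1) \<star> \<mu>)"
    and v: "\<And>n. 0 \<le> v n" "v \<longlonglongrightarrow> w"
    and \<mu>: "prob_space \<mu>" and [simp, measurable_cong]: "sets \<mu> = sets borel"
  shows "distr M borel Y = (gaussian 0 (w *\<^sub>R mat 1) \<star> \<mu>)"
proof (rule measure_eqI_bounded_continuous)
  interpret \<mu>: prob_space \<mu> by fact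
  interpret G: prob_space "std_gaussian :: (real^'n) measure" by (rule prob_space_std_gaussian)
  interpret P: pair_prob_space "std_gaussian :: (real^'n) measure" \<mu> ..
  have "0 \<le> w" using v by (metis LIMSEQ_le_const)
  show "finite_measure (distr M borel Y)" by (rule finite_measure_distr) simp
  show "finite_measure (gaussian 0 (w *\<^sub>R mat 1) \<star> \<mu>)"
    by (intro convolution_finite prob_space.finite_measure[OF prob_space_gaussian] \<mu>.finite_measure_axioms) auto
  fix \<phi> :: "real^'n \<Rightarrow> real"
  assume \<phi>: "continuous_on UNIV \<phi>" and range: "\<And>x. 0 \<le> \<phi> x \<and> \<phi> x \<le> 1"
  have [measurable]: "\<phi> \<in> borel_measurable borel" using \<phi> by (rule borel_measurable_continuous_onI)
  have cont: "(\<lambda>n. \<phi> (x n)) \<longlonglongrightarrow> \<phi> y" if "x \<longlonglongrightarrow> y" for x y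
    using \<phi> that by (metis UNIV_I continuous_on_eq_continuous_at isCont_tendsto_compose open_UNIV)
  have rep: "(LINT x|(gaussian 0 (u *\<^sub>R mat 1) \<star> \<mu>). \<phi> x) = (LINT p|(std_gaussian \<Otimes>\<^sub>M \<mu>). \<phi> (sqrt u *\<^sub>R fst p + snd p))"
    if "0 \<le> u" for u
    using that by (simp add: convolution_gaussian_eq_distr \<mu> integral_distr case_prod_beta')
  have "(\<lambda>n. LINT \<omega>|M. \<phi> (S n \<omega>)) \<longlonglongrightarrow> (LINT \<omega>|M. \<phi> (Y \<omega>))"
  proof (rule integral_dominated_convergence[where w = "\<lambda>_. 1"])
    show "AE \<omega> in M. (\<lambda>n. \<phi> (S n \<omega>)) \<longlonglongrightarrow> \<phi> (Y \<omega>)"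
      using lim by eventually_elim (rule cont)
  qed (use range in auto)
  moreover have "(LINT \<omega>|M. \<phi> (S n \<omega>)) = (LINT p|(std_gaussian \<Otimes>\<^sub>M \<mu>). \<phi> (sqrt (v n) *\<^sub>R fst p + snd p))" for n
    using rep[OF v(1)] by (simp add: law[symmetric] integral_distr)
  moreover have "(\<lambda>n. LINT p|(std_gaussian \<Otimes>\<^sub>M \<mu>). \<phi> (sqrt (v n) *\<^sub>R fst p + snd p))
      \<longlonglongrightarrow> (LINT p|(std_gaussian \<Otimes>\<^sub>M \<mu>). \<phi> (sqrt w *\<^sub>R fst p + snd p))"
  proof (rule integral_dominated_convergence[where w = "\<lambda>_. 1"])
    show "AE p in std_gaussian \<Otimes>\<^sub>M \<mu>. (\<lambda>n. \<phi> (sqrt (v n) *\<^sub>R fst p + snd p)) \<longlonglongrightarrow> \<phi> (sqrt w *\<^sub>R fst p + snd p)"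
      by (intro AE_I2 cont tendsto_intros v)
  qed (use range in auto)
  ultimately have "(LINT \<omega>|M. \<phi> (Y \<omega>)) = (LINT p|(std_gaussian \<Otimes>\<^sub>M \<mu>). \<phi> (sqrt w *\<^sub>R fst p + snd p))"
    using LIMSEQ_unique by simp
  then show "(LINT x|distr M borel Y. \<phi> x) = (LINT x|(gaussian 0 (w *\<^sub>R mat 1) \<star> \<mu>). \<phi> x)"
    using rep[OF \<open>0 \<le> w\<close>] by (simp add: integral_distr)
qed simp_all

section \<open>Weighted Brownian increments and functionals of the path\<close>

context brownian_motion
begin

lemma distr_scaled_increment:
  assumes "0 \<le> r" "r < t" "0 \<le> k"
  shows "distr M borel (\<lambda>\<omega>. k *\<^sub>R (B t \<omega> - B r \<omega>)) = gaussian 0 ((k\<^sup>2 * (t - r)) *\<^sub>R mat 1)"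
proof -
  have [measurable]: "B t \<in> borel_measurable M" "B r \<in> borel_measurable M"
    using assms by (auto intro: rv)
  have "distr M borel (\<lambda>\<omega>. k *\<^sub>R (B t \<omega> - B r \<omega>)) = distr (distr M borel (\<lambda>\<omega>. B t \<omega> - B r \<omega>)) borel ((*\<^sub>R) k)"
    by (simp add: distr_distr comp_def)
  also have "\<dots> = distr (distr std_gaussian borel (\<lambda>z. sqrt (t - r) *\<^sub>R z)) borel ((*\<^sub>R) k)"
    using assms gaussian_increments[of r t] by (simp add: gaussian_scaled_mat)
  also have "\<dots> = gaussian 0 ((k\<^sup>2 * (t - r)) *\<^sub>R mat 1)"
    using assms by (simp add: distr_distr comp_def gaussian_scaled_mat real_sqrt_mult)
  finally show ?thesis .
qed

text \<open>The last increment is independent of the weighted sum of the earlier ones, so each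
  induction step is a convolution of Gaussians. The partition increases strictly because the law of
  an increment is given for r < t.\<close>

lemma distr_weighted_increments:
  assumes \<tau>: "0 \<le> \<tau> 0" "\<And>i. \<tau> i < \<tau> (Suc i)" and w: "\<And>i. 0 \<le> w i"
  shows "distr M borel (\<lambda>\<omega>. \<Sum>i<k. w i *\<^sub>R (B (\<tau> (Suc i)) \<omega> - B (\<tau> i) \<omega>))
    = gaussian 0 ((\<Sum>i<k. (w i)\<^sup>2 * (\<tau> (Suc i) - \<tau> i)) *\<^sub>R mat 1)"
proof (induction k)
  case 0
  show ?case by (simp add: gaussian_zero)
next
  case (Suc k)
  have "mono \<tau>" using \<tau>(2) by (intro strict_mono_mono) (simp add: strict_mono_Suc_iff)
  then have \<tau>_pos: "0 \<le> \<tau> i" for i using \<tau>(1) by (metis le0 monoD order_trans)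
  have [measurable]: "B (\<tau> i) \<in> borel_measurable M" for i by (rule rv[OF \<tau>_pos])
  let ?D = "\<lambda>i \<omega>. B (\<tau> (Suc i)) \<omega> - B (\<tau> i) \<omega>"
  have "indep_var (Pi\<^sub>M {..<k} (\<lambda>_. borel)) (\<lambda>\<omega>. restrict (\<lambda>i. ?D i \<omega>) {..<k})
      (Pi\<^sub>M {k} (\<lambda>_. borel)) (\<lambda>\<omega>. restrict (\<lambda>i. ?D i \<omega>) {k})"
    by (rule indep_var_restrict[OF indep_increments[OF \<tau>(1) \<open>mono \<tau>\<close>, of "Suc k"]]) auto
  from indep_var_compose[OF this, of "\<lambda>p. \<Sum>i<k. w i *\<^sub>R p i" borel "\<lambda>p. w k *\<^sub>R p k" borel]
  have "indep_var borel (\<lambda>\<omega>. \<Sum>i<k. w i *\<^sub>R ?D i \<omega>) borel (\<lambda>\<omega>. w k *\<^sub>R ?D k \<omega>)"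
    by (simp add: comp_def)
  from sum_indep_random_variable[OF this]
  have "distr M borel (\<lambda>\<omega>. \<Sum>i<Suc k. w i *\<^sub>R ?D i \<omega>)
    = (distr M borel (\<lambda>\<omega>. \<Sum>i<k. w i *\<^sub>R ?D i \<omega>) \<star> distr M borel (\<lambda>\<omega>. w k *\<^sub>R ?D k \<omega>))"
    by simp
  also have "\<dots> = gaussian 0 ((\<Sum>i<Suc k. (w i)\<^sup>2 * (\<tau> (Suc i) - \<tau> i)) *\<^sub>R mat 1)"
    unfolding Suc distr_scaled_increment[OF \<tau>_pos \<tau>(2) w] sum.lessThan_Suc
    using \<tau>(2) by (intro convolution_gaussian sum_nonneg) (simp_all add: less_imp_le)
  finally show ?case .
qed

text \<open>A product-measurable functional of the path generates a sub sigma algebra of that of the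
  path, so it inherits independence from Y.\<close>

lemma indep_var_path_functional:
  assumes [measurable]: "Y \<in> borel_measurable M"
    and G: "G \<in> borel_measurable (\<Pi>\<^sub>M t\<in>{0..}. borel)"
    and indep: "indep_set (sets (vimage_algebra (space M) Y borel))
       (sets (vimage_algebra (space M) (\<lambda>\<omega>. \<lambda>t\<in>{0..}. B t \<omega>) (\<Pi>\<^sub>M t\<in>{0..}. borel)))"
  shows "indep_var borel Y borel (\<lambda>\<omega>. G (\<lambda>t\<in>{0..}. B t \<omega>))"
proof -
  let ?p = "\<lambda>\<omega>. \<lambda>t\<in>{0..}. B t \<omega>" and ?P = "(\<Pi>\<^sub>M t\<in>{0..}. borel) :: (real \<Rightarrow> real^'n) measure"
  have p: "?p \<in> measurable M ?P"
    by (rule measurable_restrict) (auto intro: rv)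
  have "?p \<in> measurable (vimage_algebra (space M) ?p ?P) ?P"
    by (rule measurable_vimage_algebra1) (auto simp: space_PiM)
  from measurable_compose[OF this G]
  have G': "(\<lambda>\<omega>. G (?p \<omega>)) \<in> borel_measurable (vimage_algebra (space M) ?p ?P)" .
  have sub: "{(\<lambda>\<omega>. G (?p \<omega>)) -` A \<inter> space M | A. A \<in> sets borel} \<subseteq> sets (vimage_algebra (space M) ?p ?P)"
    using measurable_sets[OF G'] by auto
  have "sigma_sets (space M) {(\<lambda>\<omega>. G (?p \<omega>)) -` A \<inter> space M | A. A \<in> sets borel}
      \<subseteq> sets (vimage_algebra (space M) ?p ?P)"
    using sets.sigma_sets_subset[OF sub] by simp
  then have "indep_set (sigma_sets (space M) {Y -` A \<inter> space M | A. A \<in> sets borel})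
     (sigma_sets (space M) {(\<lambda>\<omega>. G (?p \<omega>)) -` A \<inter> space M | A. A \<in> sets borel})"
    using indep unfolding indep_sets2_eq sets_vimage_algebra by blast
  then show ?thesis
    unfolding indep_var_eq using measurable_compose[OF p G] by simp
qed

end

text \<open>Common to both schemes: the plain one has a = lam, b = \<delta> and K empty, the
  freezing one a = s lam, b = sqrt s \<delta> and K the grid points. The center c may be any
  solution of its equation, not only \<open>exp_center\<close>.\<close>

lemma sde_solution_law:
  fixes X B :: "real \<Rightarrow> 'w \<Rightarrow> real^'n"
  assumes sol: "sde_solution M B a b \<gamma> \<rho>0 X" and a: "0 < a" and b: "0 \<le> b" and T: "0 \<le> T"
    and K: "finite K" and \<gamma>: "\<And>t. t \<in> {0<..<T} - K \<Longrightarrow> isCont \<gamma> t"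
    and c: "c 0 = 0" "continuous_on {0..T} c"
      "\<And>t. t \<in> {0<..<T} - K \<Longrightarrow> (c has_vector_derivative - a *\<^sub>R (c t - \<gamma> t)) (at t)"
  shows "law M X T = (gaussian 0 ((b\<^sup>2 / (2 * a) * (1 - exp (- 2 * a * T))) *\<^sub>R mat 1) \<star>
     distr \<rho>0 borel (scale_shift (exp (- a * T)) (c T)))"
proof -
  interpret brownian_motion M B using sol by (simp add: sde_solution_def)
  have X [measurable]: "\<And>t. 0 \<le> t \<Longrightarrow> X t \<in> borel_measurable M"
    and X_cont: "AE \<omega> in M. continuous_on {0..} (\<lambda>t. X t \<omega>)"
    and law0: "distr M borel (X 0) = \<rho>0"
    and indep: "indep_set (sets (vimage_algebra (space M) (X 0) borel))
       (sets (vimage_algebra (space M) (\<lambda>\<omega>. \<lambda>t\<in>{0..}. B t \<omega>) (\<Pi>\<^sub>M t\<in>{0..}. borel)))"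
    and eq: "AE \<omega> in M. \<forall>t\<ge>0. (\<lambda>r. X r \<omega> - \<gamma> r) integrable_on {0..t} \<and>
        X t \<omega> = X 0 \<omega> + integral {0..t} (\<lambda>r. - a *\<^sub>R (X r \<omega> - \<gamma> r)) + b *\<^sub>R B t \<omega>"
    using sol by (auto simp: sde_solution_def law_def)
  have [measurable]: "X 0 \<in> borel_measurable M" by (rule X) simp
  define \<mu> where "\<mu> = distr \<rho>0 borel (scale_shift (exp (- a * T)) (c T))"
  have [measurable]: "scale_shift k z \<in> borel_measurable borel" for k and z :: "real^'n"
    by (simp add: scale_shift_def[abs_def])
  have \<mu>: "\<mu> = distr M borel (\<lambda>\<omega>. scale_shift (exp (- a * T)) (c T) (X 0 \<omega>))"
    by (simp add: \<mu>_def law0[symmetric] distr_distr comp_def)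
  have "prob_space \<mu>" unfolding \<mu> by (rule prob_space_distr) simp
  show ?thesis
  \<comment> \<open>At T = 0 the partitions are not strictly increasing; there the Gaussian factor
    is the Dirac measure at 0.\<close>
  proof (cases "T = 0")
    case True
    have "scale_shift 1 0 = (\<lambda>x::real^'n. x)" by (auto simp: scale_shift_def)
    then have "law M X T = \<mu>" using True c(1) by (simp add: \<mu> law_def)
    moreover have "(return borel 0 \<star> \<mu>) = \<mu>"
      using \<open>prob_space \<mu>\<close> by (intro convolution_return_zero prob_space.finite_measure) (simp_all add: \<mu>_def)
    ultimately show ?thesis
      unfolding \<mu>_def[symmetric] using True by (simp add: gaussian_zero)
  next
    case False
    with T have "0 < T" by simp
    define g where "g r = exp (- a * (T - r))" for r
    define \<tau> where "\<tau> n i = T * real i / real (Suc n)" for n i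
    define S where "S n \<omega> = (\<Sum>i<Suc n. (b * g (\<tau> n i)) *\<^sub>R (B (\<tau> n (Suc i)) \<omega> - B (\<tau> n i) \<omega>))" for n \<omega>
    define v where "v n = (\<Sum>i<Suc n. (b * g (\<tau> n i))\<^sup>2 * (\<tau> n (Suc i) - \<tau> n i))" for n
    define Y where "Y \<omega> = scale_shift (exp (- a * T)) (c T) (X 0 \<omega>)" for \<omega>
    have \<tau>_0: "0 \<le> \<tau> n i" for n i using T by (simp add: \<tau>_def)
    have \<tau>_mono: "\<tau> n i < \<tau> n (Suc i)" for n i
      using \<open>0 < T\<close> by (simp add: \<tau>_def divide_strict_right_mono)
    have [measurable]: "B (\<tau> n i) \<in> borel_measurable M" for n i by (rule rv[OF \<tau>_0])
    have [measurable]: "S n \<in> borel_measurable M" for n unfolding S_def by measurable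
    have [measurable]: "Y \<in> borel_measurable M" unfolding Y_def by measurable
    have S_law: "distr M borel (S n) = gaussian 0 (v n *\<^sub>R mat 1)" for n
      unfolding S_def v_def
      by (rule distr_weighted_increments) (use \<tau>_0 \<tau>_mono b in \<open>auto simp: g_def\<close>)
    have S_Y: "distr M borel (\<lambda>\<omega>. S n \<omega> + Y \<omega>) = (gaussian 0 (v n *\<^sub>R mat 1) \<star> \<mu>)" for n
    proof -
      \<comment> \<open>\<open>S n\<close> as a finite combination of path coordinates, hence
        measurable for the product sigma algebra in which independence of \<open>X 0\<close> is
        given.\<close>
      define G where "G p = (\<Sum>i<Suc n. (b * g (\<tau> n i)) *\<^sub>R (p (\<tau> n (Suc i)) - p (\<tau> n i)))"
        for p :: "real \<Rightarrow> real^'n"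
      have G: "G \<in> borel_measurable (\<Pi>\<^sub>M t\<in>{0..}. borel)"
        unfolding G_def using \<tau>_0 by (intro borel_measurable_sum borel_measurable_scaleR borel_measurable_diff
            borel_measurable_const measurable_component_singleton) auto
      have S_G: "S n = (\<lambda>\<omega>. G (\<lambda>t\<in>{0..}. B t \<omega>))"
        unfolding S_def[abs_def] G_def using \<tau>_0 by (intro ext sum.cong) auto
      have "indep_var borel (X 0) borel (S n)"
        unfolding S_G by (rule indep_var_path_functional[OF _ G indep]) simp
      then have "indep_var borel (scale_shift (exp (- a * T)) (c T) \<circ> X 0) borel ((\<lambda>x. x) \<circ> S n)"
        by (rule indep_var_compose) simp_all
      then have "indep_var borel Y borel (S n)"
        unfolding comp_def Y_def[symmetric] .
      from sum_indep_random_variable[OF this]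
      have "distr M borel (\<lambda>\<omega>. Y \<omega> + S n \<omega>) = (distr M borel Y \<star> distr M borel (S n))"
        by simp
      also have "\<dots> = (\<mu> \<star> gaussian 0 (v n *\<^sub>R mat 1))"
        unfolding S_law \<mu> Y_def[abs_def] ..
      also have "\<dots> = (gaussian 0 (v n *\<^sub>R mat 1) \<star> \<mu>)"
        by (intro convolution_commutative prob_space.finite_measure prob_space_gaussian \<open>prob_space \<mu>\<close>) (simp_all add: \<mu>)
      finally show ?thesis
        by (simp add: add.commute)
    qed
    have g': "(g has_real_derivative a * g r) (at r within A)" for r A
      unfolding g_def by (auto intro!: derivative_eq_intros)
    have v_lim: "v \<longlonglongrightarrow> b\<^sup>2 / (2 * a) * (1 - exp (- 2 * a * T))"
    proof -
      \<comment> \<open>The variances are sums of k against increments of time, so the convergence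
        lemma applies with the identity as path. Since k' = 2 a k, the function r k - k / (2 a) is a
        primitive of the integrand 2 a k r.\<close>
      define k where "k r = (b * g r)\<^sup>2" for r
      have k': "(k has_real_derivative 2 * a * k r) (at r within A)" for r A
        unfolding k_def by (auto intro!: derivative_eq_intros g' simp: power2_eq_square)
      have "(\<lambda>n. \<Sum>i<Suc n. k (T * real i / real (Suc n)) *\<^sub>R (T * real (Suc i) / real (Suc n) - T * real i / real (Suc n)))
        \<longlonglongrightarrow> k T *\<^sub>R T - k 0 *\<^sub>R 0 - integral {0..T} (\<lambda>r. (2 * a * k r) *\<^sub>R r)"
        using T a by (intro riemann_stieltjes_sum_tendsto k') (auto simp: k_def g_def intro!: continuous_intros)
      moreover have "((\<lambda>r. (2 * a * k r) *\<^sub>R r) has_integral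
         (k T * T - k T / (2 * a)) - (k 0 * 0 - k 0 / (2 * a))) {0..T}"
      proof (rule fundamental_theorem_of_calculus[OF T])
        fix r
        have "((\<lambda>r. k r * r - k r / (2 * a)) has_real_derivative 2 * a * k r * r) (at r within {0..T})"
          using a by (auto intro!: derivative_eq_intros k')
        then show "((\<lambda>r. k r * r - k r / (2 * a)) has_vector_derivative (2 * a * k r) *\<^sub>R r) (at r within {0..T})"
          by (simp add: has_real_derivative_iff_has_vector_derivative)
      qed
      moreover have "k T = b\<^sup>2" "k 0 = b\<^sup>2 * exp (- 2 * a * T)"
        by (simp_all add: k_def g_def power_mult_distrib exp_double[symmetric])
      ultimately show ?thesis
        unfolding v_def[abs_def] \<tau>_def k_def[symmetric] by (simp add: integral_unique algebra_simps diff_divide_distrib)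
    qed
    have lim: "AE \<omega> in M. (\<lambda>n. S n \<omega> + Y \<omega>) \<longlonglongrightarrow> X T \<omega>"
      using eq X_cont start_zero continuous_paths
    proof eventually_elim
      case (elim \<omega>)
      define \<beta> where "\<beta> t = B t \<omega>" for t
      have \<beta>: "continuous_on {0..T} \<beta>" "\<beta> 0 = 0"
        using elim(3,4) by (auto simp: \<beta>_def[abs_def] intro: continuous_on_subset)
      have x: "continuous_on {0..T} (\<lambda>t. X t \<omega>)"
        using elim(2) by (rule continuous_on_subset) auto
      have int: "(\<lambda>r. X r \<omega> - \<gamma> r) integrable_on {0..T}"
        using elim(1) T by blast
      have X_eq: "X t \<omega> = X 0 \<omega> + integral {0..t} (\<lambda>r. - a *\<^sub>R (X r \<omega> - \<gamma> r)) + b *\<^sub>R \<beta> t" if "t \<in> {0..T}" for t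
        unfolding \<beta>_def using elim(1) that by (meson atLeastAtMost_iff)
      have "X T \<omega> = exp (- a * T) *\<^sub>R X 0 \<omega> + c T + b *\<^sub>R (\<beta> T - exp_center a \<beta> T)"
        by (rule integral_equation_explicit[OF T x \<beta> int X_eq K \<gamma> c])
      \<comment> \<open>Since e^(-aT) e^(ar) = g r, this is the integral in the limit of the
        Riemann-Stieltjes sums with weight g.\<close>
      also have "exp_center a \<beta> T = integral {0..T} (\<lambda>r. (a * g r) *\<^sub>R \<beta> r)"
        unfolding exp_center_def integral_cmul[symmetric] scaleR_scaleR
        by (simp add: g_def mult.left_commute exp_add[symmetric] algebra_simps)
      finally have XT: "X T \<omega> = b *\<^sub>R (\<beta> T - integral {0..T} (\<lambda>r. (a * g r) *\<^sub>R \<beta> r)) + Y \<omega>"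
        by (simp add: Y_def scale_shift_def)
      have "(\<lambda>n. \<Sum>i<Suc n. g (T * real i / real (Suc n)) *\<^sub>R
             (\<beta> (T * real (Suc i) / real (Suc n)) - \<beta> (T * real i / real (Suc n))))
         \<longlonglongrightarrow> g T *\<^sub>R \<beta> T - g 0 *\<^sub>R \<beta> 0 - integral {0..T} (\<lambda>r. (a * g r) *\<^sub>R \<beta> r)"
        using a by (intro riemann_stieltjes_sum_tendsto T \<beta> g') (auto simp: g_def intro!: continuous_intros)
      \<comment> \<open>The boundary terms reduce to \<open>\<beta> T\<close> because g T = 1 and
        \<beta> 0 = 0.\<close>
      then have "(\<lambda>n. b *\<^sub>R (\<Sum>i<Suc n. g (\<tau> n i) *\<^sub>R (\<beta> (\<tau> n (Suc i)) - \<beta> (\<tau> n i))) + Y \<omega>) \<longlonglongrightarrow> X T \<omega>"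
        unfolding XT \<tau>_def by (intro tendsto_intros) (simp add: \<beta> g_def)
      then show ?case
        unfolding S_def \<beta>_def scaleR_sum_right scaleR_scaleR .
    qed
    show ?thesis
      unfolding law_def \<mu>_def[symmetric]
    proof (rule distr_limit_gaussian_convolution[OF _ _ lim S_Y _ v_lim \<open>prob_space \<mu>\<close>])
      show "0 \<le> v n" for n
        unfolding v_def using \<tau>_mono by (intro sum_nonneg mult_nonneg_nonneg) (auto intro: less_imp_le)
    qed (use T in \<open>auto simp: \<mu>_def\<close>)
  qed
qed

section \<open>The consensus point along a continuous process\<close>

lemma sde_solution_regular:
  assumes "sde_solution M B a b \<gamma> \<rho>0 X"
  shows "prob_space M" "\<And>t. 0 \<le> t \<Longrightarrow> X t \<in> borel_measurable M"
    "AE \<omega> in M. continuous_on {0..} (\<lambda>t. X t \<omega>)"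
  using assms unfolding sde_solution_def brownian_motion_def by blast+

text \<open>The bound C is a dominating function uniform in time, so almost sure continuity of the
  paths suffices and no moment bounds have to be propagated along the process.\<close>

lemma continuous_on_integral_law:
  fixes X :: "real \<Rightarrow> 'w \<Rightarrow> real^'n" and \<psi> :: "real^'n \<Rightarrow> 'b::{banach, second_countable_topology}"
  assumes "prob_space M" and X: "\<And>t. 0 \<le> t \<Longrightarrow> X t \<in> borel_measurable M"
    and X_cont: "AE \<omega> in M. continuous_on {0..} (\<lambda>t. X t \<omega>)"
    and \<psi>: "continuous_on UNIV \<psi>" and bound: "\<And>x. norm (\<psi> x) \<le> C"
  shows "continuous_on {0..} (\<lambda>t. LINT x|law M X t. \<psi> x)"
proof (rule continuous_on_sequentiallyI)
  interpret prob_space M by fact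
  have [measurable]: "\<psi> \<in> borel_measurable borel" using \<psi> by (rule borel_measurable_continuous_onI)
  fix u :: "nat \<Rightarrow> real" and t assume u: "\<forall>n. u n \<in> {0..}" "t \<in> {0..}" "u \<longlonglongrightarrow> t"
  then have [measurable]: "X (u n) \<in> borel_measurable M" "X t \<in> borel_measurable M" for n
    by (auto intro: X)
  have "(\<lambda>n. LINT \<omega>|M. \<psi> (X (u n) \<omega>)) \<longlonglongrightarrow> (LINT \<omega>|M. \<psi> (X t \<omega>))"
  proof (rule integral_dominated_convergence[where w = "\<lambda>_. C"])
    show "AE \<omega> in M. (\<lambda>n. \<psi> (X (u n) \<omega>)) \<longlonglongrightarrow> \<psi> (X t \<omega>)"
      using X_cont
    proof eventually_elim
      case (elim \<omega>)
      have "continuous_on {0..} (\<lambda>t. \<psi> (X t \<omega>))"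
        using continuous_on_compose2[OF \<psi> elim] by simp
      then show ?case using u unfolding continuous_on_sequentially comp_def by blast
    qed
  qed (auto simp: bound)
  then show "(\<lambda>n. LINT x|law M X (u n). \<psi> x) \<longlonglongrightarrow> (LINT x|law M X t. \<psi> x)"
    by (simp add: law_def integral_distr)
qed

text \<open>The constant adds the bounds of two regions. In the ball of radius R the weight
  e^(-\<alpha> (f - m)) is at most 1. Outside, e^y >= y and the growth give e^(\<alpha> (f - m)) >=
  \<alpha> k |x|^2 >= \<alpha> k R |x|, so the weighted norm is at most 1 / (\<alpha> k R).\<close>

lemma norm_exp_weight_bounded:
  fixes f :: "'a::real_normed_vector \<Rightarrow> real"
  assumes "0 < \<alpha>" "0 < k" "0 < R" and m: "\<And>x. m \<le> f x"
    and growth: "\<And>x. R \<le> norm x \<Longrightarrow> k * (norm x)\<^sup>2 \<le> f x - m"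
  shows "exp (- \<alpha> * f x) * norm x \<le> exp (- \<alpha> * m) * (R + 1 / (\<alpha> * k * R))"
proof -
  have "exp (- \<alpha> * (f x - m)) * norm x \<le> R + 1 / (\<alpha> * k * R)"
  proof (cases "norm x \<le> R")
    case True
    have "exp (- \<alpha> * (f x - m)) * norm x \<le> 1 * R"
      using assms m[of x] True by (intro mult_mono) auto
    also have "\<dots> \<le> R + 1 / (\<alpha> * k * R)" using assms by simp
    finally show ?thesis .
  next
    case False
    let ?u = "norm x"
    have u: "0 < ?u" "R \<le> ?u" using False \<open>0 < R\<close> by linarith+
    have "\<alpha> * k * ?u\<^sup>2 \<le> exp (\<alpha> * k * ?u\<^sup>2)"
      using exp_ge_add_one_self[of "\<alpha> * k * ?u\<^sup>2"] by linarith
    also have "\<dots> \<le> exp (\<alpha> * (f x - m))"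
      using growth[OF u(2)] \<open>0 < \<alpha>\<close> by (simp add: mult.assoc)
    finally have "\<alpha> * k * ?u * ?u \<le> exp (\<alpha> * (f x - m))"
      by (simp add: power2_eq_square mult.assoc)
    moreover have "\<alpha> * k * R * ?u \<le> \<alpha> * k * ?u * ?u"
      using u assms by (intro mult_mono) auto
    ultimately have "\<alpha> * k * R * ?u \<le> exp (\<alpha> * (f x - m))"
      by linarith
    then have "exp (- \<alpha> * (f x - m)) * (\<alpha> * k * R * ?u) \<le> exp (- \<alpha> * (f x - m)) * exp (\<alpha> * (f x - m))"
      by (intro mult_left_mono) auto
    also have "\<dots> = 1" by (simp add: exp_add[symmetric])
    finally have "exp (- \<alpha> * (f x - m)) * ?u \<le> 1 / (\<alpha> * k * R)"
      using pos_le_divide_eq[of "\<alpha> * k * R" "exp (- \<alpha> * (f x - m)) * ?u" 1] assms(1-3)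
      by (simp add: ac_simps)
    then show ?thesis using \<open>0 < R\<close> by linarith
  qed
  moreover have "exp (- \<alpha> * f x) = exp (- \<alpha> * m) * exp (- \<alpha> * (f x - m))"
    by (simp add: exp_add[symmetric] algebra_simps)
  ultimately show ?thesis by (simp add: mult.assoc)
qed

lemma continuous_on_consensus_point_law:
  fixes X :: "real \<Rightarrow> 'w \<Rightarrow> real^'n"
  assumes M: "prob_space M" and X: "\<And>t. 0 \<le> t \<Longrightarrow> X t \<in> borel_measurable M"
    and X_cont: "AE \<omega> in M. continuous_on {0..} (\<lambda>t. X t \<omega>)"
    and f: "continuous_on UNIV f" and pos: "0 < \<alpha>" "0 < k" "0 < R" and m: "\<And>x. m \<le> f x"
    and growth: "\<And>x. R \<le> norm x \<Longrightarrow> k * (norm x)\<^sup>2 \<le> f x - m"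
  shows "continuous_on {0..} (\<lambda>t. consensus_point \<alpha> f (law M X t))"
proof -
  have [measurable]: "f \<in> borel_measurable borel" using f by (rule borel_measurable_continuous_onI)
  have bound: "exp (- \<alpha> * f x) \<le> exp (- \<alpha> * m)" for x
    using m[of x] pos by simp
  have num: "continuous_on {0..} (\<lambda>t. LINT x|law M X t. exp (- \<alpha> * f x) *\<^sub>R x)"
    by (rule continuous_on_integral_law[OF M X X_cont, where C = "exp (- \<alpha> * m) * (R + 1 / (\<alpha> * k * R))"])
       (use norm_exp_weight_bounded[OF pos m growth] in \<open>auto intro!: continuous_intros f\<close>)
  have den: "continuous_on {0..} (\<lambda>t. LINT x|law M X t. exp (- \<alpha> * f x))"
    by (rule continuous_on_integral_law[OF M X X_cont, where C = "exp (- \<alpha> * m)"])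
       (use bound in \<open>auto intro!: continuous_intros f\<close>)
  have pos_den: "0 < (LINT x|law M X t. exp (- \<alpha> * f x))" if "0 \<le> t" for t
  proof -
    interpret L: prob_space "law M X t"
      unfolding law_def using X[OF that] by (rule prob_space.prob_space_distr[OF M])
    have [measurable_cong]: "sets (law M X t) = sets borel" by (simp add: law_def)
    show ?thesis
    proof (rule L.expectation_greater)
      show "integrable (law M X t) (\<lambda>x. exp (- \<alpha> * f x))"
        by (rule L.integrable_const_bound[where B = "exp (- \<alpha> * m)"]) (use bound in auto)
    qed simp
  qed
  have "(LINT x|law M X t. exp (- \<alpha> * f x)) \<noteq> 0" if "t \<in> {0..}" for t
    using pos_den[of t] that by simp
  then show ?thesis
    unfolding consensus_point_def by (intro continuous_on_scaleR continuous_on_inverse num den ballI)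
qed

section \<open>The centers of both schemes\<close>

text \<open>The input cancels in c - d, which leaves the homogeneous equation.\<close>

lemma linear_ode_center_unique:
  fixes c d :: "real \<Rightarrow> 'a::banach"
  assumes "0 \<le> T" "finite K"
    and c: "c 0 = 0" "continuous_on {0..T} c"
      "\<And>t. t \<in> {0<..<T} - K \<Longrightarrow> (c has_vector_derivative - a *\<^sub>R (c t - \<gamma> t)) (at t)"
    and d: "d 0 = 0" "continuous_on {0..T} d"
      "\<And>t. t \<in> {0<..<T} - K \<Longrightarrow> (d has_vector_derivative - a *\<^sub>R (d t - \<gamma> t)) (at t)"
  shows "c T = d T"
proof -
  have "c T - d T = 0"
  proof (rule linear_ode_zero_unique[where h = "\<lambda>t. c t - d t" and a = a, OF \<open>0 \<le> T\<close> _ _ \<open>finite K\<close>])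
    fix t assume t: "t \<in> {0<..<T} - K"
    show "((\<lambda>t. c t - d t) has_vector_derivative - a *\<^sub>R (c t - d t)) (at t)"
      using has_vector_derivative_diff[OF c(3)[OF t] d(3)[OF t]] by (simp add: algebra_simps)
  qed (use c d in \<open>auto intro: continuous_intros\<close>)
  then show ?thesis by simp
qed

lemma cbo_center_exp_center:
  fixes \<gamma> :: "real \<Rightarrow> real^'n"
  assumes \<gamma>: "continuous_on {0..} \<gamma>"
  shows "cbo_center a \<gamma> (exp_center a \<gamma>)"
  unfolding cbo_center_def center_ode_def
proof (intro conjI ballI)
  fix t :: real assume t: "t \<in> {0..}"
  \<comment> \<open>Derivatives are local, so the half-line may be cut to a compact interval; t + 1
    leaves room to the right of t.\<close>
  have at: "at t within {0..} = at t within ({0..t + 1} - {})"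
    by (rule at_within_nhd[of _ "{..<t + 1}"]) auto
  show "(exp_center a \<gamma> has_vector_derivative - a *\<^sub>R (exp_center a \<gamma> t - \<gamma> t)) (at t within {0..})"
    unfolding at
  proof (rule exp_center_has_vector_derivative)
    show "(\<lambda>r. (a * exp (a * r)) *\<^sub>R \<gamma> r) integrable_on {0..t + 1}"
      by (intro integrable_continuous_real continuous_intros continuous_on_subset[OF \<gamma>]) auto
    show "continuous (at t within {0..t + 1} - {}) \<gamma>"
      using \<gamma> t unfolding continuous_on_eq_continuous_within at[symmetric] by auto
  qed (use t in auto)
qed simp

lemma cbo_center_regular:
  assumes "cbo_center a \<gamma> c"
  shows "c 0 = 0" "continuous_on {0..T} c"
    "0 < t \<Longrightarrow> (c has_vector_derivative - a *\<^sub>R (c t - \<gamma> t)) (at t)"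
proof -
  have c: "c 0 = 0" "\<And>t. 0 \<le> t \<Longrightarrow> (c has_vector_derivative - a *\<^sub>R (c t - \<gamma> t)) (at t within {0..})"
    using assms by (auto simp: cbo_center_def center_ode_def)
  then have "continuous_on {0..} c"
    by (auto simp: continuous_on_eq_continuous_within intro: has_vector_derivative_continuous)
  then show "c 0 = 0" "continuous_on {0..T} c"
    using c(1) by (auto intro: continuous_on_subset)
  show "(c has_vector_derivative - a *\<^sub>R (c t - \<gamma> t)) (at t)" if "0 < t"
    using c(2)[of t] that at_within_interior[of t "{0..}"] by simp
qed

lemma freezing_gamma_on_cell:
  assumes "0 < \<Delta>t" "t \<in> {real i * \<Delta>t..<real (Suc i) * \<Delta>t}"
  shows "freezing_gamma \<alpha> f \<Delta>t \<rho> t = consensus_point \<alpha> f (\<rho> (real i * \<Delta>t))"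
proof -
  have "\<lfloor>t / \<Delta>t\<rfloor> = int i"
    using assms by (intro floor_unique) (auto simp: field_simps)
  then show ?thesis by (simp add: freezing_gamma_def)
qed

lemma grid_cell_exists:
  fixes t \<Delta>t :: real
  assumes "0 < \<Delta>t" "0 \<le> t"
  obtains i where "t \<in> {real i * \<Delta>t..<real (Suc i) * \<Delta>t}"
proof -
  define i where "i = nat \<lfloor>t / \<Delta>t\<rfloor>"
  have "0 \<le> t / \<Delta>t" using assms by simp
  then have "real i \<le> t / \<Delta>t" "t / \<Delta>t < real (Suc i)"
    unfolding i_def by linarith+
  then have "t \<in> {real i * \<Delta>t..<real (Suc i) * \<Delta>t}"
    using assms(1) by (simp only: pos_le_divide_eq pos_divide_less_eq atLeastLessThan_iff)
  then show ?thesis by (rule that)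
qed

lemma finite_grid:
  assumes "0 < \<Delta>t"
  shows "finite (range (\<lambda>i. real i * \<Delta>t) \<inter> {0..T})"
proof -
  have "range (\<lambda>i. real i * \<Delta>t) \<inter> {0..T} \<subseteq> (\<lambda>i. real i * \<Delta>t) ` {..nat \<lceil>T / \<Delta>t\<rceil>}"
  proof
    fix x assume "x \<in> range (\<lambda>i. real i * \<Delta>t) \<inter> {0..T}"
    then obtain i where i: "x = real i * \<Delta>t" "real i * \<Delta>t \<le> T" by auto
    then have "real i \<le> T / \<Delta>t" using assms by (simp add: field_simps)
    then have "i \<le> nat \<lceil>T / \<Delta>t\<rceil>" by linarith
    with i show "x \<in> (\<lambda>i. real i * \<Delta>t) ` {..nat \<lceil>T / \<Delta>t\<rceil>}" by auto
  qed
  then show ?thesis by (rule finite_subset) simp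
qed

lemma open_grid_cell:
  fixes t \<Delta>t :: real
  assumes "0 < \<Delta>t" "t \<in> {0<..<T} - range (\<lambda>i. real i * \<Delta>t) \<inter> {0..T}"
  obtains i where "t \<in> {real i * \<Delta>t<..<real (Suc i) * \<Delta>t}"
proof -
  have "0 \<le> t" using assms by auto
  with assms(1) obtain i where i: "t \<in> {real i * \<Delta>t..<real (Suc i) * \<Delta>t}"
    by (rule grid_cell_exists)
  moreover have "t \<noteq> real i * \<Delta>t" using assms by auto
  ultimately show ?thesis using that[of i] by auto
qed

lemma continuous_on_freezing_gamma_cell:
  assumes "0 < \<Delta>t"
  shows "continuous_on {real i * \<Delta>t..<real (Suc i) * \<Delta>t} (freezing_gamma \<alpha> f \<Delta>t \<rho>)"
  by (rule continuous_on_eq[OF continuous_on_const freezing_gamma_on_cell[OF assms, symmetric]])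

lemma isCont_freezing_gamma:
  assumes "0 < \<Delta>t" "t \<in> {real i * \<Delta>t<..<real (Suc i) * \<Delta>t}"
  shows "isCont (freezing_gamma \<alpha> f \<Delta>t \<rho>) t"
  by (rule continuous_on_interior[OF continuous_on_freezing_gamma_cell[OF assms(1)]])
    (use assms(2) in \<open>simp only: interior_atLeastLessThan\<close>)

lemma freezing_gamma_weighted_integrable:
  fixes \<rho> :: "real \<Rightarrow> (real^'n) measure"
  assumes "0 < \<Delta>t" and w: "continuous_on UNIV w"
  shows "(\<lambda>r. w r *\<^sub>R freezing_gamma \<alpha> f \<Delta>t \<rho> r) integrable_on {0..T}"
proof -
  let ?F = "\<lambda>r. w r *\<^sub>R freezing_gamma \<alpha> f \<Delta>t \<rho> r"
  have "?F integrable_on {0..real i * \<Delta>t}" for i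
  proof (induction i)
    case 0
    show ?case using has_integral_refl(2)[of ?F 0] by (auto simp: integrable_on_def)
  next
    case (Suc i)
    have const: "(\<lambda>r. w r *\<^sub>R consensus_point \<alpha> f (\<rho> (real i * \<Delta>t))) integrable_on {real i * \<Delta>t..real (Suc i) * \<Delta>t}"
      by (intro integrable_continuous_real continuous_intros continuous_on_subset[OF w]) auto
    have eq: "?F r = w r *\<^sub>R consensus_point \<alpha> f (\<rho> (real i * \<Delta>t))"
      if "r \<in> {real i * \<Delta>t..real (Suc i) * \<Delta>t} - {real (Suc i) * \<Delta>t}" for r
    proof -
      have "r \<in> {real i * \<Delta>t..<real (Suc i) * \<Delta>t}" using that by auto
      from freezing_gamma_on_cell[OF assms(1) this] show ?thesis by (rule arg_cong)
    qed
    have "?F integrable_on {real i * \<Delta>t..real (Suc i) * \<Delta>t}"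
      by (rule integrable_spike_finite[where S = "{real (Suc i) * \<Delta>t}", OF _ eq const]) simp
    from Henstock_Kurzweil_Integration.integrable_combine[OF _ _ Suc this] show ?case
      using assms(1) by (simp add: mult_right_mono)
  qed
  moreover obtain i where "T / \<Delta>t < real i" using reals_Archimedean2 by blast
  then have "{0..T} \<subseteq> {0..real i * \<Delta>t}" using assms(1) by (auto simp: field_simps)
  ultimately show ?thesis by (rule integrable_subinterval_real)
qed

lemma freezing_center_exp_center:
  fixes \<rho> :: "real \<Rightarrow> (real^'n) measure"
  assumes "0 < \<Delta>t"
  shows "freezing_center \<Delta>t a (freezing_gamma \<alpha> f \<Delta>t \<rho>) (exp_center a (freezing_gamma \<alpha> f \<Delta>t \<rho>))"
  unfolding freezing_center_def center_ode_def
proof (intro conjI allI ballI)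
  let ?\<gamma> = "freezing_gamma \<alpha> f \<Delta>t \<rho>"
  have int: "(\<lambda>r. (a * exp (a * r)) *\<^sub>R ?\<gamma> r) integrable_on {0..T}" for T
    by (intro freezing_gamma_weighted_integrable assms continuous_intros)
  show "continuous_on {0..} (exp_center a ?\<gamma>)" by (rule continuous_on_exp_center[OF int])
  fix i t assume t: "t \<in> {real i * \<Delta>t..<real (Suc i) * \<Delta>t}"
  have cell: "{real i * \<Delta>t..<real (Suc i) * \<Delta>t} = {real i * \<Delta>t..real (Suc i) * \<Delta>t} - {real (Suc i) * \<Delta>t}"
    by auto
  have cont: "continuous (at t within {real i * \<Delta>t..real (Suc i) * \<Delta>t} - {real (Suc i) * \<Delta>t}) ?\<gamma>"
    using continuous_on_freezing_gamma_cell[OF assms, of i] t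
    unfolding continuous_on_eq_continuous_within cell by blast
  show "(exp_center a ?\<gamma> has_vector_derivative - a *\<^sub>R (exp_center a ?\<gamma> t - ?\<gamma> t))
      (at t within {real i * \<Delta>t..<real (Suc i) * \<Delta>t})"
    unfolding cell
    by (rule exp_center_has_vector_derivative[OF int _ _ t[unfolded cell] cont]) (use assms in simp_all)
qed simp

lemma freezing_center_regular:
  assumes "freezing_center \<Delta>t a \<gamma> c"
  shows "c 0 = 0" "continuous_on {0..T} c"
    "t \<in> {real i * \<Delta>t<..<real (Suc i) * \<Delta>t} \<Longrightarrow> (c has_vector_derivative - a *\<^sub>R (c t - \<gamma> t)) (at t)"
proof -
  show "c 0 = 0" "continuous_on {0..T} c"
    using assms by (auto simp: freezing_center_def intro: continuous_on_subset)
  assume t: "t \<in> {real i * \<Delta>t<..<real (Suc i) * \<Delta>t}"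
  then have "(c has_vector_derivative - a *\<^sub>R (c t - \<gamma> t)) (at t within {real i * \<Delta>t..<real (Suc i) * \<Delta>t})"
    using assms by (auto simp: freezing_center_def center_ode_def)
  then have "(c has_vector_derivative - a *\<^sub>R (c t - \<gamma> t)) (at t within {real i * \<Delta>t<..<real (Suc i) * \<Delta>t})"
    by (rule has_vector_derivative_within_subset) auto
  then show "(c has_vector_derivative - a *\<^sub>R (c t - \<gamma> t)) (at t)"
    unfolding at_within_open[OF t open_greaterThanLessThan] .
qed

section \<open>Laws of the two schemes\<close>

lemma cbo_solution_law:
  fixes X :: "real \<Rightarrow> 'w \<Rightarrow> real^'n"
  assumes sol: "cbo_solution f \<alpha> lam \<delta> M B \<rho>0 X" and pos: "0 < lam" "0 < \<delta>"
    and \<gamma>: "continuous_on {0..} (cbo_gamma \<alpha> f (law M X))"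
    and c: "cbo_center lam (cbo_gamma \<alpha> f (law M X)) c" and "0 \<le> t"
  shows "law M X t = (gaussian 0 (diffusion_cov lam \<delta> t) \<star>
     distr \<rho>0 borel (scale_shift (contraction lam t) (c t)))"
proof -
  have "isCont (cbo_gamma \<alpha> f (law M X)) r" if "0 < r" for r
    using continuous_on_interior[OF \<gamma>, of r] that by simp
  then have "law M X t = (gaussian 0 ((\<delta>\<^sup>2 / (2 * lam) * (1 - exp (- 2 * lam * t))) *\<^sub>R mat 1) \<star>
     distr \<rho>0 borel (scale_shift (exp (- lam * t)) (c t)))"
    using sol pos cbo_center_regular[OF c] \<open>0 \<le> t\<close> unfolding cbo_solution_def
    by (intro sde_solution_law[where K = "{}"]) auto
  then show ?thesis by (simp add: diffusion_cov_def contraction_def Let_def)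
qed

text \<open>The speed s cancels in (sqrt s \<delta>)^2 / (2 s lam) = \<delta>^2 / (2 lam) and
  survives only in the exponents. Hence contraction and covariance are those of the plain scheme at
  time s t, while c, which solves the equation with rate s lam, is taken at t.\<close>

lemma freezing_solution_law:
  fixes X :: "real \<Rightarrow> 'w \<Rightarrow> real^'n"
  assumes sol: "freezing_solution f \<alpha> lam \<delta> s \<Delta>t M B \<rho>0 X" and pos: "0 < lam" "0 < \<delta>" "0 < s" "0 < \<Delta>t"
    and c: "freezing_center \<Delta>t (s * lam) (freezing_gamma \<alpha> f \<Delta>t (law M X)) c" and "0 \<le> t"
  shows "law M X t = (gaussian 0 (diffusion_cov lam \<delta> (s * t)) \<star>
     distr \<rho>0 borel (scale_shift (contraction lam (s * t)) (c t)))"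
proof -
  let ?K = "range (\<lambda>i. real i * \<Delta>t) \<inter> {0..t}"
  have "law M X t = (gaussian 0 (((sqrt s * \<delta>)\<^sup>2 / (2 * (s * lam)) * (1 - exp (- 2 * (s * lam) * t))) *\<^sub>R mat 1) \<star>
     distr \<rho>0 borel (scale_shift (exp (- (s * lam) * t)) (c t)))"
  proof (rule sde_solution_law[where K = ?K, OF sol[unfolded freezing_solution_def]])
    fix r assume r: "r \<in> {0<..<t} - ?K"
    with pos(4) obtain i where i: "r \<in> {real i * \<Delta>t<..<real (Suc i) * \<Delta>t}" by (rule open_grid_cell)
    show "isCont (freezing_gamma \<alpha> f \<Delta>t (law M X)) r"
      by (rule isCont_freezing_gamma[OF pos(4) i])
    show "(c has_vector_derivative - (s * lam) *\<^sub>R (c r - freezing_gamma \<alpha> f \<Delta>t (law M X) r)) (at r)"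
      by (rule freezing_center_regular(3)[OF c i])
  qed (use pos \<open>0 \<le> t\<close> finite_grid freezing_center_regular[OF c] in auto)
  moreover have "(sqrt s * \<delta>)\<^sup>2 / (2 * (s * lam)) = \<delta>\<^sup>2 / 2 / lam"
    using pos by (simp add: power_mult_distrib)
  moreover have "- 2 * (s * lam) * t = - 2 * lam * (s * t)" "- (s * lam) * t = - lam * (s * t)"
    by (simp_all add: algebra_simps)
  ultimately show ?thesis by (simp only: diffusion_cov_def contraction_def Let_def)
qed

text \<open>Each center is asserted to exist and to be unique, so that c is indeed the solution of
  its equation. Uniqueness is for t >= 0 because the equation does not constrain c at negative
  times.\<close>

theorem theorem3p18:
  fixes f :: "real^'n \<Rightarrow> real" and xstar :: "real^'n"
    and L c_l c_u R \<alpha> lam \<delta> s \<Delta>t :: real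
    and \<rho>0 \<eta>0 :: "(real^'n) measure"
    and M1 :: "'a measure" and B1 X1 :: "real \<Rightarrow> 'a \<Rightarrow> real^'n"
    and M2 :: "'b measure" and B2 X2 :: "real \<Rightarrow> 'b \<Rightarrow> real^'n"
  assumes "continuous_on UNIV f"
    and "\<forall>x. f xstar \<le> f x" and "\<forall>x. f x = f xstar \<longrightarrow> x = xstar"
    and "L > 0" and "\<forall>x y. \<bar>f x - f y\<bar> \<le> L * (1 + norm x + norm y) * norm (x - y)"
    and "c_l > 0" and "c_u > 0" and "R > 0"
    and "\<forall>x. f x - f xstar \<le> c_u * ((norm x)\<^sup>2 + 1)"
    and "\<forall>x. norm x \<ge> R \<longrightarrow> c_l * (norm x)\<^sup>2 \<le> f x - f xstar"
    and "\<alpha> > 0" and "lam > 0" and "\<delta> > 0" and "s > 0" and "\<Delta>t > 0"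
    and "\<rho>0 \<in> P2" and "\<eta>0 \<in> P2"
    and "cbo_solution f \<alpha> lam \<delta> M1 B1 \<rho>0 X1"
    and "freezing_solution f \<alpha> lam \<delta> s \<Delta>t M2 B2 \<eta>0 X2"
  shows
    "(\<exists>c. cbo_center lam (cbo_gamma \<alpha> f (law M1 X1)) c \<and>
        (\<forall>c'. cbo_center lam (cbo_gamma \<alpha> f (law M1 X1)) c' \<longrightarrow> (\<forall>t\<ge>0. c' t = c t)) \<and>
        (\<forall>t\<ge>0. law M1 X1 t =
           (gaussian 0 (diffusion_cov lam \<delta> t) \<star>
            distr \<rho>0 borel (scale_shift (contraction lam t) (c t))))) \<and>
     (\<exists>c. freezing_center \<Delta>t (s * lam) (freezing_gamma \<alpha> f \<Delta>t (law M2 X2)) c \<and>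
        (\<forall>c'. freezing_center \<Delta>t (s * lam) (freezing_gamma \<alpha> f \<Delta>t (law M2 X2)) c' \<longrightarrow>
           (\<forall>t\<ge>0. c' t = c t)) \<and>
        (\<forall>t\<ge>0. law M2 X2 t =
           (gaussian 0 (diffusion_cov lam \<delta> (s * t)) \<star>
            distr \<eta>0 borel (scale_shift (contraction lam (s * t)) (c t)))))"
proof (rule conjI)
  let ?\<gamma>1 = "cbo_gamma \<alpha> f (law M1 X1)" and ?\<gamma>2 = "freezing_gamma \<alpha> f \<Delta>t (law M2 X2)"
  note f = \<open>continuous_on UNIV f\<close> and pos = \<open>\<alpha> > 0\<close> \<open>c_l > 0\<close> \<open>R > 0\<close> \<open>lam > 0\<close> \<open>\<delta> > 0\<close> \<open>s > 0\<close> \<open>\<Delta>t > 0\<close>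
  note growth = \<open>\<forall>x. norm x \<ge> R \<longrightarrow> c_l * (norm x)\<^sup>2 \<le> f x - f xstar\<close>
  note sol1 = \<open>cbo_solution f \<alpha> lam \<delta> M1 B1 \<rho>0 X1\<close> and sol2 = \<open>freezing_solution f \<alpha> lam \<delta> s \<Delta>t M2 B2 \<eta>0 X2\<close>
  \<comment> \<open>The lower growth of f enters here, with the minimum \<open>f xstar\<close> as m.
    Continuity of the input is what allows an empty exceptional set in the plain scheme.\<close>
  have \<gamma>1: "continuous_on {0..} ?\<gamma>1"
    unfolding cbo_gamma_def
    using sde_solution_regular[OF sol1[unfolded cbo_solution_def]]
    by (rule continuous_on_consensus_point_law[where m = "f xstar" and k = c_l and R = R])
       (use \<open>\<forall>x. f xstar \<le> f x\<close> growth pos in \<open>simp_all add: f\<close>)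
  have c1: "cbo_center lam ?\<gamma>1 (exp_center lam ?\<gamma>1)"
    by (rule cbo_center_exp_center[OF \<gamma>1])
  have unique1: "c' t = exp_center lam ?\<gamma>1 t" if "cbo_center lam ?\<gamma>1 c'" "0 \<le> t" for c' t
    by (rule linear_ode_center_unique[where K = "{}" and a = lam and \<gamma> = ?\<gamma>1])
       (use that cbo_center_regular[OF that(1)] cbo_center_regular[OF c1] in auto)
  show "\<exists>c. cbo_center lam ?\<gamma>1 c \<and> (\<forall>c'. cbo_center lam ?\<gamma>1 c' \<longrightarrow> (\<forall>t\<ge>0. c' t = c t)) \<and>
        (\<forall>t\<ge>0. law M1 X1 t = (gaussian 0 (diffusion_cov lam \<delta> t) \<star>
            distr \<rho>0 borel (scale_shift (contraction lam t) (c t))))"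
    using c1 unique1 cbo_solution_law[OF sol1 pos(4,5) \<gamma>1 c1] by blast
  have c2: "freezing_center \<Delta>t (s * lam) ?\<gamma>2 (exp_center (s * lam) ?\<gamma>2)"
    by (rule freezing_center_exp_center[OF pos(7)])
  have unique2: "c' t = exp_center (s * lam) ?\<gamma>2 t" if c': "freezing_center \<Delta>t (s * lam) ?\<gamma>2 c'" and t: "0 \<le> t" for c' t
  proof (rule linear_ode_center_unique[where a = "s * lam" and \<gamma> = ?\<gamma>2, OF t finite_grid[OF pos(7)]])
    fix r assume "r \<in> {0<..<t} - range (\<lambda>i. real i * \<Delta>t) \<inter> {0..t}"
    with pos(7) obtain i where i: "r \<in> {real i * \<Delta>t<..<real (Suc i) * \<Delta>t}" by (rule open_grid_cell)
    show "(c' has_vector_derivative - (s * lam) *\<^sub>R (c' r - ?\<gamma>2 r)) (at r)"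
      "(exp_center (s * lam) ?\<gamma>2 has_vector_derivative - (s * lam) *\<^sub>R (exp_center (s * lam) ?\<gamma>2 r - ?\<gamma>2 r)) (at r)"
      by (rule freezing_center_regular(3)[OF c' i] freezing_center_regular(3)[OF c2 i])+
  qed (use freezing_center_regular[OF c'] freezing_center_regular[OF c2] in auto)
  show "\<exists>c. freezing_center \<Delta>t (s * lam) ?\<gamma>2 c \<and>
        (\<forall>c'. freezing_center \<Delta>t (s * lam) ?\<gamma>2 c' \<longrightarrow> (\<forall>t\<ge>0. c' t = c t)) \<and>
        (\<forall>t\<ge>0. law M2 X2 t = (gaussian 0 (diffusion_cov lam \<delta> (s * t)) \<star>
            distr \<eta>0 borel (scale_shift (contraction lam (s * t)) (c t))))"
    using c2 unique2 freezing_solution_law[OF sol2 pos(4-7) c2] by blast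
qed

end
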